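(* Let $b^* := b-3$. For any $\alpha\in\mathbb{N}$, any $\mu,\nu\in\mathbb{C}$ and any $z\in\mathbb{C}$ with $|z|<1$, the second-order correlation function $f(n,m)=f(n,m;\mu,\nu)$ of the characteristic polynomial of an unrescaled real sample covariance matrix satisfies $$ \sum_{m=0}^{\infty} \frac{f(m+\alpha,m)}{(m+\alpha)!\,m!}\, z^m = \exp\left(-(\mu+\nu)\frac{z}{1-z}+b^*z\right)\sum_{k=0}^{\infty}\frac{(\mu\nu z)^k}{(k+\alpha)!\,k!}\,(1-z)^{-2k-\alpha-3}. $$
   Context: Here $\mathbb{N}=\{0,1,2,\dots\}$. Let $Q$ be a probability distribution on the real line with expectation $0$, variance $1$ and finite fourth moment $b$ (i.e. $b=\int x^4\,dQ(x)<\infty$). For $n,m\in\mathbb{N}$ with $n\ge m$, let $X=X(n,m)=(X_{ij})_{i=1,\dots,n;\,j=1,\dots,m}$ be the $n\times m$ random matrix whose entries are i.i.d. real random variables with distribution $Q$. Let $X^T$ be the transpose of $X$; the $m\times m$ matrix $X(n,m)^TX(n,m)$ is the unrescaled real sample covariance matrix associated with $Q$. For $\mu,\nu\in\mathbb{C}$ the second-order correlation function of its characteristic polynomial is $$ f(n,m;\mu,\nu):=\mathbb{E}\big(\det(X(n,m)^TX(n,m)-\mu)\,\det(X(n,m)^TX(n,m)-\nu)\big), $$ where $\mu,\nu$ inside the determinants stand for $\mu I_m,\nu I_m$. The determinant of the $0\times0$ matrix is defined to be $1$, so $f(n,0;\mu,\nu)=1$. *)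

theory Defs
  imports "HOL-Probability.Probability" "Jordan_Normal_Form.Determinant"
begin

text \<open>
  HOL-Analysis also has constants \<open>det\<close> and \<open>mat\<close>, for matrices whose dimensions are types.
  Here the dimensions vary inside the statement, so matrices are those of \<open>Jordan_Normal_Form\<close>
  (indices start at 0; the determinant of the \<open>0 \<times> 0\<close> matrix is 1).
\<close>

definition iid_random_matrix ::
  "'a measure \<Rightarrow> real measure \<Rightarrow> nat \<Rightarrow> nat \<Rightarrow> ('a \<Rightarrow> real Matrix.mat) \<Rightarrow> bool" where
  "iid_random_matrix M Q n m X \<longleftrightarrow>
     (\<forall>\<omega>\<in>space M. X \<omega> \<in> carrier_mat n m) \<and>
     prob_space.indep_vars M (\<lambda>_. borel) (\<lambda>(i, j) \<omega>. X \<omega> $$ (i, j)) ({..<n} \<times> {..<m}) \<and>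
     (\<forall>i<n. \<forall>j<m. distr M borel (\<lambda>\<omega>. X \<omega> $$ (i, j)) = Q)"

definition sample_cov :: "real Matrix.mat \<Rightarrow> real Matrix.mat" where
  "sample_cov A = transpose_mat A * A"

definition det_shift :: "real Matrix.mat \<Rightarrow> complex \<Rightarrow> complex" where
  "det_shift S \<mu> = Determinant.det (map_mat complex_of_real S - \<mu> \<cdot>\<^sub>m 1\<^sub>m (dim_row S))"

definition corr2 :: "'a measure \<Rightarrow> ('a \<Rightarrow> real Matrix.mat) \<Rightarrow> complex \<Rightarrow> complex \<Rightarrow> complex" where
  "corr2 M X \<mu> \<nu> =
     (LINT \<omega>|M. det_shift (sample_cov (X \<omega>)) \<mu> * det_shift (sample_cov (X \<omega>)) \<nu>)"

end

theory Submission
  imports Defs "Jordan_Normal_Form.Char_Poly"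
begin

text \<open>
  The expectation is computed by a recursion in the number \<open>n\<close> of rows. Adding a row \<open>x\<close> replaces
  \<open>S = X\<^sup>T X\<close> by \<open>S + x x\<^sup>T\<close>, so \<open>p(\<mu>) = det (\<mu> - S)\<close> becomes \<open>p(\<mu>) - x\<^sup>T adj(\<mu> - S) x\<close>. Averaging
  \<open>p(\<mu>) p(\<nu>)\<close> over \<open>x\<close> involves \<open>tr adj(\<mu> - S) = p'(\<mu>)\<close>, the diagonal minors, which carry the factor
  \<open>b - 3\<close>, and \<open>tr (adj(\<mu> - S) adj(\<nu> - S))\<close>, which the resolvent identity turns into
  \<open>(p'(\<mu>) p(\<nu>) - p(\<mu>) p'(\<nu>)) / (\<nu> - \<mu>)\<close>. Hence \<open>f(n, m)\<close> satisfies the closed recursion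
  \<open>f(n+1, m) = ((1 - \<partial>\<^sub>\<mu>) (1 - \<partial>\<^sub>\<nu>) + 2 (\<partial>\<^sub>\<mu> - \<partial>\<^sub>\<nu>) / (\<nu> - \<mu>)) f(n, m) + (b - 3) m f(n, m-1)\<close>,
  with \<open>f(0, m) = (\<mu> \<nu>)\<^sup>m\<close>. In the exponential generating function in \<open>x\<close> and \<open>y\<close> its solution is
  \<open>(1 - x y)\<^sup>-\<^sup>3 exp ((x + \<mu> \<nu> y - (\<mu> + \<nu>) x y) / (1 - x y) + (b - 3) x y)\<close>, of which the theorem
  is the diagonal \<open>n = m + \<alpha>\<close>.

  Each entry occurs in \<open>p(\<mu>) p(\<nu>)\<close> with degree at most 4, so the distribution \<open>Q\<close> may be replaced by
  any linear functional with the same moments of order at most 4, such as a signed quadrature rule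
  with five nodes. Being defined on all functions, it raises no question of integrability.
\<close>

section \<open>Rank-one updates of characteristic polynomials\<close>

text \<open>Matrix determinant lemma. The bordered matrix \<open>N\<close> has determinant
  \<open>det (A - U * V)\<close>; multiplying it by \<open>?G\<close>, built from the adjugate,
  gives a block triangular matrix of determinant \<open>?d ^ n * (?d - s)\<close>. As
  \<open>det ?G = ?d ^ n\<close>, a nonzero power of \<open>det A\<close> remains to be
  cancelled.\<close>

lemma det_rank_one_downdate:
  fixes A :: "'a :: idom Matrix.mat"
  assumes A: "A \<in> carrier_mat n n" and nz: "Determinant.det A \<noteq> 0"
  shows "Determinant.det (A - Matrix.mat n n (\<lambda>(i, j). u i * v j))
    = Determinant.det A - (\<Sum>i<n. \<Sum>j<n. v i * adj_mat A $$ (i, j) * u j)"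
proof -
  define U where "U = Matrix.mat n 1 (\<lambda>(i, j :: nat). u i)"
  define V where "V = Matrix.mat 1 n (\<lambda>(i :: nat, j). v j)"
  define N where "N = four_block_mat A U V (1\<^sub>m 1)"
  define s where "s = (\<Sum>i<n. \<Sum>j<n. v i * adj_mat A $$ (i, j) * u j)"
  let ?d = "Determinant.det A"
  have U: "U \<in> carrier_mat n 1" and V: "V \<in> carrier_mat 1 n"
    by (auto simp: U_def V_def)
  have N: "N \<in> carrier_mat (n + 1) (n + 1)"
    unfolding N_def using A U V by auto
  note adj = adj_mat[OF A]
  \<comment> \<open>Block row elimination of \<open>U\<close>.\<close>
  have "four_block_mat (1\<^sub>m n) (- U) (0\<^sub>m 1 n) (1\<^sub>m 1) * N
      = four_block_mat (A - U * V) (0\<^sub>m n 1) V (1\<^sub>m 1)"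
    unfolding N_def
    by (subst mult_four_block_mat[of _ n n _ 1 _ 1 _ _ n _ 1])
       (use A U V in \<open>auto intro!: cong_four_block_mat eq_matI simp: scalar_prod_def\<close>)
  hence "Determinant.det (four_block_mat (1\<^sub>m n) (- U) (0\<^sub>m 1 n) (1\<^sub>m 1)) * Determinant.det N
      = Determinant.det (four_block_mat (A - U * V) (0\<^sub>m n 1) V (1\<^sub>m 1))"
    using det_mult[OF _ N, of "four_block_mat (1\<^sub>m n) (- U) (0\<^sub>m 1 n) (1\<^sub>m 1)"] U
    by (metis four_block_carrier_mat one_carrier_mat)
  moreover have "Determinant.det (four_block_mat (1\<^sub>m n) (- U) (0\<^sub>m 1 n) (1\<^sub>m 1)) = 1"
    by (subst det_four_block_mat_lower_left_zero[of _ n _ 1]) (use U in auto)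
  moreover have "Determinant.det (four_block_mat (A - U * V) (0\<^sub>m n 1) V (1\<^sub>m 1))
      = Determinant.det (A - U * V)"
    by (subst det_four_block_mat_upper_right_zero[of _ n _ 1]) (use A U V in auto)
  ultimately have detN: "Determinant.det N = Determinant.det (A - U * V)" by simp
  have VaU: "V * (adj_mat A * U) = s \<cdot>\<^sub>m 1\<^sub>m 1"
    unfolding s_def using adj(1) U V
    by (intro eq_matI) (auto simp: scalar_prod_def U_def V_def sum_distrib_left
        atLeast0LessThan mult.assoc intro!: sum.cong)
  \<comment> \<open>Elimination of \<open>V\<close> with the adjugate in place of the inverse, so
    that no division occurs.\<close>
  let ?G = "four_block_mat (adj_mat A) (0\<^sub>m n 1) (- (V * adj_mat A)) (?d \<cdot>\<^sub>m 1\<^sub>m 1)"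
  have G: "?G \<in> carrier_mat (n + 1) (n + 1)" using adj(1) V by auto
  have "V * (?d \<cdot>\<^sub>m 1\<^sub>m n) = ?d \<cdot>\<^sub>m V"
    using V by (simp add: mult_smult_distrib[of V 1 n "1\<^sub>m n" n])
  hence VaA: "V * (adj_mat A * A) = ?d \<cdot>\<^sub>m V"
    unfolding adj(3) .
  have "?G * N = four_block_mat (?d \<cdot>\<^sub>m 1\<^sub>m n) (adj_mat A * U) (0\<^sub>m 1 n) ((?d - s) \<cdot>\<^sub>m 1\<^sub>m 1)"
    unfolding N_def
  proof (subst mult_four_block_mat[of _ n n _ 1 _ 1 _ _ n _ 1], goal_cases)
    case 9
    have *: "- (V * adj_mat A) * A = - (?d \<cdot>\<^sub>m V)" "- (V * adj_mat A) * U = - (s \<cdot>\<^sub>m 1\<^sub>m 1)"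
      using adj(1) U V A VaA VaU
      by (simp_all add: assoc_mult_mat[of V 1 n _ n _ 1] assoc_mult_mat[of V 1 n _ n _ n] )
    show ?case
    proof (rule cong_four_block_mat, goal_cases)
      case 1 show ?case using adj U V A by (auto intro!: eq_matI simp: scalar_prod_def)
    next
      case 2 show ?case using adj(1) U V A by (auto intro!: eq_matI simp: scalar_prod_def)
    next
      case 3 show ?case unfolding * using V by (auto intro!: eq_matI simp: scalar_prod_def)
    next
      case 4 show ?case unfolding * by (auto intro!: eq_matI simp: scalar_prod_def)
    qed
  qed (use adj(1) A U V in auto)
  hence "Determinant.det ?G * Determinant.det N
    = Determinant.det (four_block_mat (?d \<cdot>\<^sub>m 1\<^sub>m n) (adj_mat A * U) (0\<^sub>m 1 n) ((?d - s) \<cdot>\<^sub>m 1\<^sub>m 1))"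
    using det_mult[OF G N] by simp
  moreover have "Determinant.det ?G = Determinant.det (adj_mat A) * ?d"
    by (subst det_four_block_mat_upper_right_zero[of _ n _ 1]) (use adj(1) V in auto)
  moreover have "Determinant.det (four_block_mat (?d \<cdot>\<^sub>m 1\<^sub>m n) (adj_mat A * U) (0\<^sub>m 1 n) ((?d - s) \<cdot>\<^sub>m 1\<^sub>m 1))
      = ?d ^ n * (?d - s)"
    by (subst det_four_block_mat_lower_left_zero[of _ n _ 1]) (use adj(1) U in auto)
  moreover have "Determinant.det (adj_mat A) * ?d = ?d ^ n"
    using det_mult[OF adj(1) A] adj(3) by simp
  ultimately have "?d ^ n * Determinant.det N = ?d ^ n * (?d - s)" by simp
  hence "Determinant.det N = ?d - s" using nz by simp
  moreover have "U * V = Matrix.mat n n (\<lambda>(i, j). u i * v j)"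
    by (intro eq_matI) (auto simp: U_def V_def scalar_prod_def)
  ultimately show ?thesis unfolding detN s_def by simp
qed

text \<open>The entries of \<open>adj (\<mu> - S)\<close>.\<close>

definition adj_char :: "'a :: comm_ring_1 Matrix.mat \<Rightarrow> 'a \<Rightarrow> nat \<Rightarrow> nat \<Rightarrow> 'a" where
  "adj_char S \<mu> i j = poly (adj_mat (char_poly_matrix S) $$ (i, j)) \<mu>"

text \<open>The downdate formula is applied over the polynomial ring, where the determinant is a
  monic polynomial and hence nonzero. Evaluating afterwards covers every \<open>\<mu>\<close>,
  eigenvalues included.\<close>

lemma char_poly_rank_one_update:
  fixes S :: "'a :: idom Matrix.mat"
  assumes S: "S \<in> carrier_mat m m"
  shows "poly (char_poly (S + Matrix.mat m m (\<lambda>(i, j). x i * x j))) \<mu>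
    = poly (char_poly S) \<mu> - (\<Sum>i<m. \<Sum>j<m. x i * x j * adj_char S \<mu> i j)"
proof -
  have C: "char_poly_matrix S \<in> carrier_mat m m" using S by simp
  have "char_poly S \<noteq> 0" using degree_monic_char_poly[OF S] by auto
  hence nz: "Determinant.det (char_poly_matrix S) \<noteq> 0" unfolding char_poly_def .
  have "char_poly_matrix (S + Matrix.mat m m (\<lambda>(i, j). x i * x j))
     = char_poly_matrix S - Matrix.mat m m (\<lambda>(i, j). [:x i:] * [:x j:])"
    using S by (intro eq_matI) (auto simp: char_poly_matrix_def)
  hence "char_poly (S + Matrix.mat m m (\<lambda>(i, j). x i * x j)) = char_poly S
     - (\<Sum>i<m. \<Sum>j<m. [:x i:] * adj_mat (char_poly_matrix S) $$ (i, j) * [:x j:])"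
    unfolding char_poly_def by (simp only: det_rank_one_downdate[OF C nz])
  thus ?thesis
    by (simp add: adj_char_def poly_sum mult_ac)
qed

lemma adj_char_diag:
  fixes S :: "'a :: comm_ring_1 Matrix.mat"
  assumes S: "S \<in> carrier_mat m m" and i: "i < m"
  shows "adj_char S \<mu> i i = poly (char_poly (mat_delete S i i)) \<mu>"
proof -
  have "char_poly_matrix (mat_delete S i i) = mat_delete (char_poly_matrix S) i i"
    using S i by (intro eq_matI) (auto simp: char_poly_matrix_def mat_delete_def)
  thus ?thesis
    using S i by (simp add: adj_char_def adj_mat_def cofactor_def char_poly_def char_poly_matrix_def)
qed

text \<open>Jacobi's formula: the derivative of the characteristic polynomial is the sum of those of
  the principal submatrices.\<close>

lemma adj_char_trace:
  fixes S :: "'a :: idom Matrix.mat"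
  assumes S: "S \<in> carrier_mat m m"
  shows "(\<Sum>i<m. adj_char S \<mu> i i) = poly (pderiv (char_poly S)) \<mu>"
  using adj_char_diag[OF S] by (simp add: pderiv_char_poly[OF S] poly_sum)

lemma mat_delete_transpose:
  "i < dim_row A \<Longrightarrow> j < dim_col A \<Longrightarrow>
    mat_delete (transpose_mat A) j i = transpose_mat (mat_delete A i j)"
  by (intro eq_matI) (auto simp: mat_delete_def)

lemma adj_char_sym:
  fixes S :: "'a :: idom Matrix.mat"
  assumes S: "S \<in> carrier_mat m m" and sym: "transpose_mat S = S" and ij: "i < m" "j < m"
  shows "adj_char S \<mu> i j = adj_char S \<mu> j i"
proof -
  let ?C = "char_poly_matrix S"
  have C: "?C \<in> carrier_mat m m" using S by simp
  have "S $$ (j, i) = S $$ (i, j)" if "i < m" "j < m" for i j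
    using arg_cong[OF sym, of "\<lambda>T. T $$ (i, j)"] S that by simp
  hence tC: "transpose_mat ?C = ?C"
    using S by (intro eq_matI) (auto simp: char_poly_matrix_def)
  have "mat_delete ?C i j = transpose_mat (mat_delete ?C j i)"
    using mat_delete_transpose[of j ?C i] C ij by (simp add: tC)
  hence "Determinant.det (mat_delete ?C i j) = Determinant.det (mat_delete ?C j i)"
    using det_transpose[OF mat_delete_carrier[OF C, of j i]] by simp
  thus ?thesis
    using C ij by (simp add: adj_char_def adj_mat_def cofactor_def add.commute)
qed

lemma adj_char_resolvent:
  fixes S :: "'a :: comm_ring_1 Matrix.mat"
  assumes S: "S \<in> carrier_mat m m"
  shows "(\<nu> - \<mu>) * (\<Sum>i<m. \<Sum>j<m. adj_char S \<mu> i j * adj_char S \<nu> j i)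
    = poly (char_poly S) \<nu> * (\<Sum>i<m. adj_char S \<mu> i i)
    - poly (char_poly S) \<mu> * (\<Sum>i<m. adj_char S \<nu> i i)"
proof -
  let ?C = "char_poly_matrix S"
  have C: "?C \<in> carrier_mat m m" using S by simp
  note adj = adj_mat[OF C]
  have dC: "Determinant.det ?C = char_poly S" by (simp add: char_poly_def)
  have Cij: "poly (?C $$ (i, j)) z = (if i = j then z else 0) - S $$ (i, j)"
    if "i < m" "j < m" for i j z
    using S that by (auto simp: char_poly_matrix_def)
  have left: "(\<Sum>j<m. adj_char S z i j * S $$ (j, k))
      = z * adj_char S z i k - (if i = k then poly (char_poly S) z else 0)"
    if ik: "i < m" "k < m" for i k z
  proof -
    have "poly ((adj_mat ?C * ?C) $$ (i, k)) z = (if i = k then poly (char_poly S) z else 0)"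
      unfolding adj(3) dC using ik by simp
    moreover have "poly ((adj_mat ?C * ?C) $$ (i, k)) z
        = (\<Sum>j<m. adj_char S z i j * ((if j = k then z else 0) - S $$ (j, k)))"
      using adj(1) C ik
      by (simp add: scalar_prod_def poly_sum adj_char_def atLeast0LessThan Cij)
    moreover have "\<dots> = z * adj_char S z i k - (\<Sum>j<m. adj_char S z i j * S $$ (j, k))"
      using ik by (simp add: right_diff_distrib sum_subtractf if_distrib[of "\<lambda>c. _ * c"] mult.commute)
    ultimately show ?thesis by (simp add: algebra_simps)
  qed
  have right: "(\<Sum>j<m. S $$ (i, j) * adj_char S z j k)
      = z * adj_char S z i k - (if i = k then poly (char_poly S) z else 0)"
    if ik: "i < m" "k < m" for i k z
  proof -
    have "poly ((?C * adj_mat ?C) $$ (i, k)) z = (if i = k then poly (char_poly S) z else 0)"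
      unfolding adj(2) dC using ik by simp
    moreover have "poly ((?C * adj_mat ?C) $$ (i, k)) z
        = (\<Sum>j<m. ((if i = j then z else 0) - S $$ (i, j)) * adj_char S z j k)"
      using adj(1) C ik
      by (simp add: scalar_prod_def poly_sum adj_char_def atLeast0LessThan Cij)
    moreover have "\<dots> = z * adj_char S z i k - (\<Sum>j<m. S $$ (i, j) * adj_char S z j k)"
      using ik by (simp add: left_diff_distrib sum_subtractf if_distrib[of "\<lambda>c. c * _"])
    ultimately show ?thesis by (simp add: algebra_simps)
  qed
  let ?T = "\<Sum>i<m. \<Sum>j<m. adj_char S \<mu> i j * adj_char S \<nu> j i"
  have "(\<Sum>i<m. \<Sum>k<m. (\<Sum>j<m. adj_char S \<mu> i j * S $$ (j, k)) * adj_char S \<nu> k i)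
      = \<mu> * ?T - poly (char_poly S) \<mu> * (\<Sum>i<m. adj_char S \<nu> i i)"
    by (simp add: left left_diff_distrib sum_subtractf sum_distrib_left mult.assoc
        if_distrib[of "\<lambda>c. c * _"])
  moreover have "(\<Sum>i<m. \<Sum>k<m. (\<Sum>j<m. adj_char S \<mu> i j * S $$ (j, k)) * adj_char S \<nu> k i)
      = (\<Sum>i<m. \<Sum>j<m. adj_char S \<mu> i j * (\<Sum>k<m. S $$ (j, k) * adj_char S \<nu> k i))"
    unfolding sum_distrib_left sum_distrib_right
  proof (rule sum.cong[OF refl], goal_cases)
    case (1 i)
    show ?case by (subst sum.swap) (simp add: mult.assoc)
  qed
  moreover have "\<dots> = \<nu> * ?T - poly (char_poly S) \<nu> * (\<Sum>i<m. adj_char S \<mu> i i)"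
    by (simp add: right right_diff_distrib sum_subtractf sum_distrib_left mult.left_commute
        if_distrib[of "\<lambda>c. _ * c"] mult.commute[of _ "poly (char_poly S) \<nu>"])
  ultimately have "\<mu> * ?T - poly (char_poly S) \<mu> * (\<Sum>i<m. adj_char S \<nu> i i)
      = \<nu> * ?T - poly (char_poly S) \<nu> * (\<Sum>i<m. adj_char S \<mu> i i)" by (simp only:)
  moreover have "(\<nu> - \<mu>) * t = q - p" if "\<mu> * t - p = \<nu> * t - q" for t p q
  proof -
    have "(\<nu> - \<mu>) * t = (\<nu> * t - q) - \<mu> * t + q" by (simp add: algebra_simps)
    also have "\<dots> = q - p" unfolding that[symmetric] by (simp add: algebra_simps)
    finally show ?thesis .
  qed
  ultimately show ?thesis by blast
qed

section \<open>Iterated linear functionals\<close>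

definition linear_functional :: "(('a \<Rightarrow> complex) \<Rightarrow> complex) \<Rightarrow> bool" where
  "linear_functional E \<longleftrightarrow>
    (\<forall>F G. E (\<lambda>x. F x + G x) = E F + E G) \<and> (\<forall>c F. E (\<lambda>x. c * F x) = c * E F)"

text \<open>
  The mean over \<open>n\<close> independent coordinates \<open>x 0, \<dots>, x (n - 1)\<close>, each averaged by \<open>E\<close>; the remaining
  coordinates are junk.
\<close>

primrec iterate_functional ::
  "(('a \<Rightarrow> complex) \<Rightarrow> complex) \<Rightarrow> nat \<Rightarrow> ((nat \<Rightarrow> 'a) \<Rightarrow> complex) \<Rightarrow> complex" where
  "iterate_functional E 0 F = F (\<lambda>_. undefined)"
| "iterate_functional E (Suc n) F = iterate_functional E n (\<lambda>x. E (\<lambda>a. F (x(n := a))))"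

context
  fixes E :: "('a \<Rightarrow> complex) \<Rightarrow> complex"
  assumes E: "linear_functional E"
begin

lemma functional_add: "E (\<lambda>x. F x + G x) = E F + E G"
  and functional_cmult: "E (\<lambda>x. c * F x) = c * E F"
  using E by (auto simp: linear_functional_def)

lemma functional_multc: "E (\<lambda>x. F x * c) = E F * c"
  using functional_cmult[of c F] by (simp add: mult.commute)

lemma functional_zero: "E (\<lambda>x. 0) = 0"
  using functional_cmult[of 0 "\<lambda>_. 0"] by simp

lemma functional_diff: "E (\<lambda>x. F x - G x) = E F - E G"
  using functional_add[of F "\<lambda>x. (-1) * G x"] functional_cmult[of "-1" G] by simp

lemma functional_sum: "E (\<lambda>x. \<Sum>i\<in>I. F i x) = (\<Sum>i\<in>I. E (F i))"
  by (induction I rule: infinite_finite_induct) (auto simp: functional_zero functional_add)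

lemma linear_iterate_functional: "linear_functional (iterate_functional E n)"
proof (induction n)
  case (Suc n)
  thus ?case by (simp add: linear_functional_def functional_add functional_cmult)
qed (simp add: linear_functional_def)

end

lemma iterate_functional_prod:
  assumes E: "linear_functional E"
  shows "iterate_functional E n (\<lambda>x. \<Prod>i<n. g i (x i)) = (\<Prod>i<n. E (g i))"
proof (induction n)
  case (Suc n)
  have "iterate_functional E (Suc n) (\<lambda>x. \<Prod>i<Suc n. g i (x i))
      = iterate_functional E n (\<lambda>x. (\<Prod>i<n. g i (x i)) * E (g n))"
    by (simp add: functional_cmult[OF E])
  thus ?case
    by (simp add: functional_multc[OF linear_iterate_functional[OF E]] Suc.IH)
qed simp

text \<open>\<open>insert_index a\<close> skips the value \<open>a\<close>, so the integrand ignores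
  coordinate \<open>a\<close>, whose average is trivial because \<open>E\<close> maps 1 to 1.
  Locality of \<open>F\<close> is required since the coordinates beyond the averaged ones are
  junk.\<close>

lemma iterate_functional_skip:
  assumes E: "linear_functional E" and E1: "E (\<lambda>_. 1) = 1"
    and loc: "\<And>x y. (\<And>j. j < m \<Longrightarrow> x j = y j) \<Longrightarrow> F x = F y" and a: "a \<le> m"
  shows "iterate_functional E (Suc m) (\<lambda>x. F (\<lambda>j. x (insert_index a j))) = iterate_functional E m F"
  using loc a
proof (induction m arbitrary: F)
  have const: "E (\<lambda>_. c) = c" for c
    using functional_cmult[OF E, of c "\<lambda>_. 1"] E1 by simp
  {
    case 0
    have "F (\<lambda>j. ((\<lambda>_. undefined)(0 := t)) (insert_index a j)) = F (\<lambda>_. undefined)" for t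
      by (rule 0) auto
    thus ?case by (simp add: const del: insert_index)
  next
    case (Suc m)
    show ?case
    \<comment> \<open>Either the last coordinate is the skipped one, or it is the last variable of
      \<open>F\<close> and can be peeled off on both sides.\<close>
    proof (cases "a = Suc m")
      case True
      have "F (\<lambda>j. (x(Suc m := t)) (insert_index a j)) = F x" for x t
        by (rule Suc.prems(1)) (auto simp: True insert_index_def)
      thus ?thesis unfolding iterate_functional.simps(2)[of E "Suc m"] by (simp add: const)
    next
      case False
      have *: "(\<lambda>j. (x(Suc m := t)) (insert_index a j)) = (\<lambda>j. x (insert_index a j))(m := t)" for x t
        using False Suc.prems(2) by (auto simp: insert_index_def fun_eq_iff)
      have "iterate_functional E (Suc (Suc m)) (\<lambda>x. F (\<lambda>j. x (insert_index a j)))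
          = iterate_functional E (Suc m) (\<lambda>x. (\<lambda>y. E (\<lambda>t. F (y(m := t)))) (\<lambda>j. x (insert_index a j)))"
        unfolding iterate_functional.simps(2)[of E "Suc m"] * ..
      also have "\<dots> = iterate_functional E m (\<lambda>y. E (\<lambda>t. F (y(m := t))))"
      proof (rule Suc.IH, goal_cases)
        case (1 x y)
        show ?case by (rule arg_cong[where f = E], rule ext, rule Suc.prems(1)) (auto simp: 1)
      qed (use False Suc.prems(2) in simp)
      finally show ?thesis by simp
    qed
  }
qed

text \<open>Marginalisation over one column, carried out row by row; it will identify the mean of a
  principal minor.\<close>

lemma iterate_functional_skip_column:
  assumes E: "linear_functional E" and E1: "E (\<lambda>_. 1) = 1"
    and loc: "\<And>X Y. (\<And>i j. i < n \<Longrightarrow> j < m \<Longrightarrow> X i j = Y i j) \<Longrightarrow> F X = F Y" and a: "a \<le> m"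
  shows "iterate_functional (iterate_functional E (Suc m)) n (\<lambda>X. F (\<lambda>i j. X i (insert_index a j)))
    = iterate_functional (iterate_functional E m) n F"
  using loc
proof (induction n arbitrary: F)
  case 0
  show ?case by (auto intro: 0)
next
  case (Suc n)
  have *: "(\<lambda>i j. (X(n := r)) i (insert_index a j))
      = (\<lambda>i j. X i (insert_index a j))(n := \<lambda>j. r (insert_index a j))" for X :: "nat \<Rightarrow> nat \<Rightarrow> 'a" and r
    by (auto simp: fun_eq_iff)
  have **: "iterate_functional E (Suc m) (\<lambda>r. F (X(n := \<lambda>j. r (insert_index a j))))
      = iterate_functional E m (\<lambda>r. F (X(n := r)))" for X
    by (rule iterate_functional_skip[OF E E1 _ a, where F = "\<lambda>r. F (X(n := r))"])
       (rule Suc.prems, auto)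
  show ?case
    unfolding iterate_functional.simps(2)[of _ n] * **
    by (rule Suc.IH, rule arg_cong[where f = "iterate_functional E m"], rule ext, rule Suc.prems) auto
qed

section \<open>Averaging over a row\<close>

lemma sum_delta_mult:
  fixes g :: "nat \<Rightarrow> 'b :: semiring_1"
  shows "(\<Sum>j<m. (if i = j then 1 else 0) * g j) = (if i < m then g i else 0)"
proof -
  have "(\<Sum>j<m. (if i = j then 1 else 0) * g j) = (\<Sum>j<m. if i = j then g j else 0)"
    by (intro sum.cong) auto
  thus ?thesis by simp
qed

locale moment_functional =
  fixes L :: "(complex \<Rightarrow> complex) \<Rightarrow> complex" and b :: complex
  assumes linear: "linear_functional L"
    and moment_0: "L (\<lambda>_. 1) = 1" and moment_1: "L (\<lambda>x. x) = 0"
    and moment_2: "L (\<lambda>x. x ^ 2) = 1" and moment_4: "L (\<lambda>x. x ^ 4) = b"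
begin

abbreviation row_mean :: "nat \<Rightarrow> ((nat \<Rightarrow> complex) \<Rightarrow> complex) \<Rightarrow> complex" where
  "row_mean \<equiv> iterate_functional L"

abbreviation array_mean :: "nat \<Rightarrow> nat \<Rightarrow> ((nat \<Rightarrow> nat \<Rightarrow> complex) \<Rightarrow> complex) \<Rightarrow> complex" where
  "array_mean n m \<equiv> iterate_functional (row_mean m) n"

lemmas linear_row = linear_iterate_functional[OF linear]
lemmas linear_array = linear_iterate_functional[OF linear_row]

lemma row_monomial: "row_mean m (\<lambda>x. \<Prod>j<m. x j ^ e j) = (\<Prod>j<m. L (\<lambda>t. t ^ e j))"
  by (rule iterate_functional_prod[OF linear])

lemma row_const: "row_mean m (\<lambda>_. c) = c"
proof -
  have "row_mean m (\<lambda>_. 1) = 1"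
    using row_monomial[of m "\<lambda>_. 0"] by (simp add: moment_0)
  thus ?thesis using functional_cmult[OF linear_row, of m c "\<lambda>_. 1"] by simp
qed

text \<open>Monomials are encoded as lists of indices, so that their means depend only on the
  multiplicities.\<close>

lemma row_list_monomial:
  assumes "set js \<subseteq> {..<m}"
  shows "row_mean m (\<lambda>x. \<Prod>j\<leftarrow>js. x j) = (\<Prod>j<m. L (\<lambda>t. t ^ count_list js j))"
proof -
  have "(\<Prod>j\<leftarrow>js. x j) = (\<Prod>j<m. x j ^ count_list js j)" for x :: "nat \<Rightarrow> complex"
    using assms
  proof (induction js)
    case (Cons a js)
    have "(\<Prod>j<m. x j ^ count_list (a # js) j)
        = (\<Prod>j<m. (if a = j then x j else 1) * x j ^ count_list js j)"
      by (intro prod.cong) auto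
    also have "\<dots> = x a * (\<Prod>j<m. x j ^ count_list js j)"
      using Cons.prems by (simp add: prod.distrib)
    finally show ?case using Cons by simp
  qed simp
  thus ?thesis by (simp add: row_monomial)
qed

text \<open>An index of multiplicity one contributes the vanishing first moment. This includes
  \<open>x i ^ 3 * x j\<close> for distinct indices, whose mean therefore does not involve the third
  moment.\<close>

lemma row_list_monomial_zero:
  assumes "set js \<subseteq> {..<m}" and "count_list js i = 1"
  shows "row_mean m (\<lambda>x. \<Prod>j\<leftarrow>js. x j) = 0"
proof -
  have "i < m" using assms by (metis One_nat_def count_notin lessThan_iff n_not_Suc_n subsetD)
  moreover have "L (\<lambda>t. t ^ count_list js i) = 0" using assms(2) by (simp add: moment_1)
  ultimately show ?thesis
    unfolding row_list_monomial[OF assms(1)] by (intro prod_zero) auto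
qed

lemma row_list_monomial_one:
  assumes "set js \<subseteq> {..<m}" and "\<And>i. count_list js i \<in> {0, 2}"
  shows "row_mean m (\<lambda>x. \<Prod>j\<leftarrow>js. x j) = 1"
proof -
  have "L (\<lambda>t. t ^ count_list js i) = 1" for i
    using assms(2)[of i] by (auto simp: moment_0 moment_2)
  thus ?thesis by (simp add: row_list_monomial[OF assms(1)])
qed

lemma row_second_moment:
  assumes "i < m" "j < m"
  shows "row_mean m (\<lambda>x. x i * x j) = (if i = j then 1 else 0)"
  using row_list_monomial_zero[of "[i, j]" m i] row_list_monomial_one[of "[i, j]" m] assms
  by (cases "i = j") auto

text \<open>Wick's formula with its correction: the three pairings already contribute 3 when all
  indices agree, so the excess is the fourth cumulant \<open>b - 3\<close>.\<close>

lemma row_fourth_moment: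
  assumes "i < m" "j < m" "k < m" "l < m"
  shows "row_mean m (\<lambda>x. x i * x j * (x k * x l))
    = (if i = j \<and> k = l then 1 else 0) + (if i = k \<and> j = l then 1 else 0)
    + (if i = l \<and> j = k then 1 else 0) + (if i = j \<and> i = k \<and> i = l then b - 3 else 0)"
proof -
  let ?js = "[i, j, k, l]"
  have js: "set ?js \<subseteq> {..<m}" using assms by simp
  have eq: "row_mean m (\<lambda>x. x i * x j * (x k * x l)) = row_mean m (\<lambda>x. \<Prod>j\<leftarrow>?js. x j)"
    by (simp add: mult.assoc)
  \<comment> \<open>Four indices all agree, form two distinct pairs in one of three ways, or contain
    one that occurs exactly once.\<close>
  consider "i = j" "i = k" "i = l"
    | "i = j" "k = l" "i \<noteq> k" | "i = k" "j = l" "i \<noteq> j" | "i = l" "j = k" "i \<noteq> j"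
    | "\<exists>p. count_list ?js p = 1"
      "\<not> (i = j \<and> k = l)" "\<not> (i = k \<and> j = l)" "\<not> (i = l \<and> j = k)"
  proof -
    have "\<exists>p\<in>{i, j, k, l}. count_list ?js p = 1"
      if "\<not> (i = j \<and> k = l)" "\<not> (i = k \<and> j = l)" "\<not> (i = l \<and> j = k)"
      using that by auto
    thus ?thesis using that by metis
  qed
  thus ?thesis
  proof cases
    case 1
    have "(\<Prod>p<m. L (\<lambda>t. t ^ count_list ?js p)) = (\<Prod>p<m. if p = i then b else 1)"
      using 1 by (intro prod.cong) (auto simp: moment_0 moment_4[unfolded power4_eq_xxxx mult.assoc])
    also have "\<dots> = b" using assms by simp
    finally show ?thesis unfolding eq row_list_monomial[OF js] using 1 by (simp del: count_list.simps)
  next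
    case 5
    then obtain p where p: "count_list ?js p = 1" by blast
    have "row_mean m (\<lambda>x. x i * x j * (x k * x l)) = 0"
      unfolding eq by (rule row_list_monomial_zero[OF js p])
    moreover have "\<not> (i = j \<and> i = k \<and> i = l)" using 5 by blast
    ultimately show ?thesis using 5 by (simp only: if_False add_0)
  next
    case 2
    have "row_mean m (\<lambda>x. x i * x j * (x k * x l)) = 1"
      unfolding eq by (rule row_list_monomial_one[OF js]) (use 2 in simp)
    thus ?thesis using 2 by simp
  next
    case 3
    have "row_mean m (\<lambda>x. x i * x j * (x k * x l)) = 1"
      unfolding eq by (rule row_list_monomial_one[OF js]) (use 3 in simp)
    thus ?thesis using 3 by simp
  next
    case 4
    have "row_mean m (\<lambda>x. x i * x j * (x k * x l)) = 1"
      unfolding eq by (rule row_list_monomial_one[OF js]) (use 4 in simp)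
    thus ?thesis using 4 by simp
  qed
qed

lemma row_quadratic:
  "row_mean m (\<lambda>x. \<Sum>i<m. \<Sum>j<m. x i * x j * B i j) = (\<Sum>i<m. B i i)"
proof -
  have "row_mean m (\<lambda>x. \<Sum>i<m. \<Sum>j<m. x i * x j * B i j)
      = (\<Sum>i<m. \<Sum>j<m. row_mean m (\<lambda>x. x i * x j) * B i j)"
    by (simp only: functional_sum[OF linear_row] functional_multc[OF linear_row])
  also have "\<dots> = (\<Sum>i<m. \<Sum>j<m. (if i = j then 1 else 0) * B i j)"
    by (intro sum.cong refl) (simp add: row_second_moment)
  also have "\<dots> = (\<Sum>i<m. B i i)"
    by (rule sum.cong[OF refl]) (simp only: sum_delta_mult lessThan_iff if_True)
  finally show ?thesis .
qed

text \<open>The pairings give the contractions tr B tr C, tr(B C^T) and tr(B C); the cumulant gives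
  the diagonal term.\<close>

lemma row_quadratic_prod:
  "row_mean m (\<lambda>x. (\<Sum>i<m. \<Sum>j<m. x i * x j * B i j) * (\<Sum>k<m. \<Sum>l<m. x k * x l * C k l))
    = (\<Sum>i<m. B i i) * (\<Sum>i<m. C i i) + (\<Sum>i<m. \<Sum>j<m. B i j * C i j)
    + (\<Sum>i<m. \<Sum>j<m. B i j * C j i) + (b - 3) * (\<Sum>i<m. B i i * C i i)"
proof -
  let ?\<delta> = "\<lambda>p. if p then 1 else 0 :: complex"
  \<comment> \<open>Conjunctions become nested factors, ordered so that the sums collapse one at a
    time by \<open>sum_delta_mult\<close>.\<close>
  have expand: "(?\<delta> (i = j \<and> k = l) + ?\<delta> (i = k \<and> j = l) + ?\<delta> (i = l \<and> j = k)
        + (if i = j \<and> i = k \<and> i = l then b - 3 else 0)) * w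
      = ?\<delta> (i = j) * (?\<delta> (k = l) * w) + ?\<delta> (i = k) * (?\<delta> (j = l) * w)
        + ?\<delta> (j = k) * (?\<delta> (i = l) * w) + ?\<delta> (i = j) * (?\<delta> (i = k) * (?\<delta> (i = l) * ((b - 3) * w)))"
    for i j k l :: nat and w
    by (cases "i = j"; cases "k = l"; cases "i = k"; cases "j = l"; cases "i = l"; cases "j = k")
       (simp_all add: distrib_right left_diff_distrib)
  have c1: "(\<Sum>i<m. \<Sum>j<m. \<Sum>k<m. \<Sum>l<m. ?\<delta> (i = j) * (?\<delta> (k = l) * (B i j * C k l)))
      = (\<Sum>i<m. B i i) * (\<Sum>i<m. C i i)"
  proof -
    have "(\<Sum>i<m. \<Sum>j<m. \<Sum>k<m. \<Sum>l<m. ?\<delta> (i = j) * (?\<delta> (k = l) * (B i j * C k l)))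
        = (\<Sum>i<m. \<Sum>j<m. ?\<delta> (i = j) * (\<Sum>k<m. \<Sum>l<m. ?\<delta> (k = l) * (B i j * C k l)))"
      by (simp only: sum_distrib_left)
    also have "\<dots> = (\<Sum>i<m. \<Sum>k<m. \<Sum>l<m. ?\<delta> (k = l) * (B i i * C k l))"
      by (rule sum.cong[OF refl]) (simp only: sum_delta_mult lessThan_iff if_True)
    also have "\<dots> = (\<Sum>i<m. \<Sum>k<m. B i i * C k k)"
      by (rule sum.cong[OF refl], rule sum.cong[OF refl]) (simp only: sum_delta_mult lessThan_iff if_True)
    also have "\<dots> = (\<Sum>i<m. B i i) * (\<Sum>i<m. C i i)"
      by (simp only: sum_product)
    finally show ?thesis .
  qed
  have c2: "(\<Sum>i<m. \<Sum>j<m. \<Sum>k<m. \<Sum>l<m. ?\<delta> (i = k) * (?\<delta> (j = l) * (B i j * C k l)))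
      = (\<Sum>i<m. \<Sum>j<m. B i j * C i j)"
  proof -
    have "(\<Sum>i<m. \<Sum>j<m. \<Sum>k<m. \<Sum>l<m. ?\<delta> (i = k) * (?\<delta> (j = l) * (B i j * C k l)))
        = (\<Sum>i<m. \<Sum>j<m. \<Sum>k<m. ?\<delta> (i = k) * (\<Sum>l<m. ?\<delta> (j = l) * (B i j * C k l)))"
      by (simp only: sum_distrib_left)
    also have "\<dots> = (\<Sum>i<m. \<Sum>j<m. B i j * C i j)"
      by (rule sum.cong[OF refl], rule sum.cong[OF refl]) (simp only: sum_delta_mult lessThan_iff if_True)
    finally show ?thesis .
  qed
  have c3: "(\<Sum>i<m. \<Sum>j<m. \<Sum>k<m. \<Sum>l<m. ?\<delta> (j = k) * (?\<delta> (i = l) * (B i j * C k l)))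
      = (\<Sum>i<m. \<Sum>j<m. B i j * C j i)"
  proof -
    have "(\<Sum>i<m. \<Sum>j<m. \<Sum>k<m. \<Sum>l<m. ?\<delta> (j = k) * (?\<delta> (i = l) * (B i j * C k l)))
        = (\<Sum>i<m. \<Sum>j<m. \<Sum>k<m. ?\<delta> (j = k) * (\<Sum>l<m. ?\<delta> (i = l) * (B i j * C k l)))"
      by (simp only: sum_distrib_left)
    also have "\<dots> = (\<Sum>i<m. \<Sum>j<m. B i j * C j i)"
      by (rule sum.cong[OF refl], rule sum.cong[OF refl]) (simp only: sum_delta_mult lessThan_iff if_True)
    finally show ?thesis .
  qed
  have c4: "(\<Sum>i<m. \<Sum>j<m. \<Sum>k<m. \<Sum>l<m. ?\<delta> (i = j) * (?\<delta> (i = k) * (?\<delta> (i = l) * ((b - 3) * (B i j * C k l)))))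
      = (b - 3) * (\<Sum>i<m. B i i * C i i)"
  proof -
    have "(\<Sum>i<m. \<Sum>j<m. \<Sum>k<m. \<Sum>l<m. ?\<delta> (i = j) * (?\<delta> (i = k) * (?\<delta> (i = l) * ((b - 3) * (B i j * C k l)))))
        = (\<Sum>i<m. \<Sum>j<m. ?\<delta> (i = j) * (\<Sum>k<m. ?\<delta> (i = k) * (\<Sum>l<m. ?\<delta> (i = l) * ((b - 3) * (B i j * C k l)))))"
      by (simp only: sum_distrib_left)
    also have "\<dots> = (\<Sum>i<m. (b - 3) * (B i i * C i i))"
      by (rule sum.cong[OF refl]) (simp only: sum_delta_mult lessThan_iff if_True)
    also have "\<dots> = (b - 3) * (\<Sum>i<m. B i i * C i i)"
      by (simp only: sum_distrib_left)
    finally show ?thesis .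
  qed
  have "row_mean m (\<lambda>x. (\<Sum>i<m. \<Sum>j<m. x i * x j * B i j) * (\<Sum>k<m. \<Sum>l<m. x k * x l * C k l))
      = row_mean m (\<lambda>x. \<Sum>i<m. \<Sum>j<m. \<Sum>k<m. \<Sum>l<m. x i * x j * (x k * x l) * (B i j * C k l))"
    unfolding sum_distrib_right unfolding sum_distrib_left by (simp only: mult_ac)
  also have "\<dots> = (\<Sum>i<m. \<Sum>j<m. \<Sum>k<m. \<Sum>l<m.
      (?\<delta> (i = j \<and> k = l) + ?\<delta> (i = k \<and> j = l) + ?\<delta> (i = l \<and> j = k)
        + (if i = j \<and> i = k \<and> i = l then b - 3 else 0)) * (B i j * C k l))"
    unfolding functional_sum[OF linear_row] functional_multc[OF linear_row]
    by (intro sum.cong refl) (simp only: row_fourth_moment lessThan_iff)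
  also have "\<dots> = (\<Sum>i<m. \<Sum>j<m. \<Sum>k<m. \<Sum>l<m. ?\<delta> (i = j) * (?\<delta> (k = l) * (B i j * C k l)))
      + (\<Sum>i<m. \<Sum>j<m. \<Sum>k<m. \<Sum>l<m. ?\<delta> (i = k) * (?\<delta> (j = l) * (B i j * C k l)))
      + (\<Sum>i<m. \<Sum>j<m. \<Sum>k<m. \<Sum>l<m. ?\<delta> (j = k) * (?\<delta> (i = l) * (B i j * C k l)))
      + (\<Sum>i<m. \<Sum>j<m. \<Sum>k<m. \<Sum>l<m. ?\<delta> (i = j) * (?\<delta> (i = k) * (?\<delta> (i = l) * ((b - 3) * (B i j * C k l)))))"
    by (simp only: expand sum.distrib)
  finally show ?thesis unfolding c1 c2 c3 c4 .
qed

end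

section \<open>The recursion in the number of rows\<close>

text \<open>The matrix X^T X, with X given as a function on pairs of indices: adding a row is then a
  function update, and the iterated functionals apply directly.\<close>

definition gram :: "nat \<Rightarrow> nat \<Rightarrow> (nat \<Rightarrow> nat \<Rightarrow> 'a :: comm_semiring_0) \<Rightarrow> 'a Matrix.mat" where
  "gram n m X = Matrix.mat m m (\<lambda>(j, k). \<Sum>i<n. X i j * X i k)"

lemma gram_carrier [simp]: "gram n m X \<in> carrier_mat m m"
  by (simp add: gram_def)

lemma transpose_gram: "transpose_mat (gram n m X) = gram n m X"
  by (intro eq_matI) (auto simp: gram_def mult.commute)

lemma gram_Suc:
  "gram (Suc n) m (X(n := r)) = gram n m X + Matrix.mat m m (\<lambda>(i, j). r i * r j)"
  by (intro eq_matI) (auto simp: gram_def)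

lemma gram_cong:
  "(\<And>i j. i < n \<Longrightarrow> j < m \<Longrightarrow> X i j = Y i j) \<Longrightarrow> gram n m X = gram n m Y"
  by (intro eq_matI) (auto simp: gram_def intro!: sum.cong)

lemma mat_delete_gram:
  "mat_delete (gram n (Suc m) X) a a = gram n m (\<lambda>i j. X i (insert_index a j))"
  by (intro eq_matI) (auto simp: gram_def mat_delete_def insert_index_def)

context moment_functional
begin

text \<open>\<open>char_poly\<close> is det(\<mu> - S) rather than det(S - \<mu>); the two signs
  \<open>(- 1) ^ m\<close> cancel in the product.\<close>

definition corr :: "nat \<Rightarrow> nat \<Rightarrow> complex \<Rightarrow> complex \<Rightarrow> complex" where
  "corr n m \<mu> \<nu> = array_mean n m
    (\<lambda>X. poly (char_poly (gram n m X)) \<mu> * poly (char_poly (gram n m X)) \<nu>)"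

text \<open>After the rank-one update the integrand is a product of two affine functions of
  quadratic forms in the new row. Their means are traces of adjugates, that is, derivatives of the
  characteristic polynomial; the mean of the product brings in the mixed trace, treated by the
  resolvent identity.\<close>

lemma row_step:
  assumes S: "S \<in> carrier_mat m m" and sym: "transpose_mat S = S"
  shows "(\<nu> - \<mu>) * row_mean m (\<lambda>x.
      poly (char_poly (S + Matrix.mat m m (\<lambda>(i, j). x i * x j))) \<mu> *
      poly (char_poly (S + Matrix.mat m m (\<lambda>(i, j). x i * x j))) \<nu>)
    = (\<nu> - \<mu>) * (poly (char_poly S) \<mu> * poly (char_poly S) \<nu>
        - poly (pderiv (char_poly S)) \<mu> * poly (char_poly S) \<nu>
        - poly (char_poly S) \<mu> * poly (pderiv (char_poly S)) \<nu>
        + poly (pderiv (char_poly S)) \<mu> * poly (pderiv (char_poly S)) \<nu>)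
    + 2 * (poly (pderiv (char_poly S)) \<mu> * poly (char_poly S) \<nu>
        - poly (char_poly S) \<mu> * poly (pderiv (char_poly S)) \<nu>)
    + (\<nu> - \<mu>) * (b - 3) * (\<Sum>a<m. poly (char_poly (mat_delete S a a)) \<mu>
        * poly (char_poly (mat_delete S a a)) \<nu>)"
proof -
  let ?B = "adj_char S \<mu>" and ?C = "adj_char S \<nu>"
  let ?p = "poly (char_poly S) \<mu>" and ?q = "poly (char_poly S) \<nu>"
  let ?p' = "poly (pderiv (char_poly S)) \<mu>" and ?q' = "poly (pderiv (char_poly S)) \<nu>"
  let ?T = "\<Sum>i<m. \<Sum>j<m. ?B i j * ?C j i"
  let ?D = "\<Sum>a<m. ?B a a * ?C a a"
  let ?Q = "\<lambda>x. \<Sum>i<m. \<Sum>j<m. x i * x j * ?B i j" and ?R = "\<lambda>x. \<Sum>i<m. \<Sum>j<m. x i * x j * ?C i j"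
  note trace = adj_char_trace[OF S]
  have "row_mean m (\<lambda>x. (?p - ?Q x) * (?q - ?R x))
      = row_mean m (\<lambda>x. ?p * ?q - ?Q x * ?q - ?p * ?R x + ?Q x * ?R x)"
    by (simp add: algebra_simps)
  also have "\<dots> = ?p * ?q - row_mean m ?Q * ?q - ?p * row_mean m ?R + row_mean m (\<lambda>x. ?Q x * ?R x)"
    by (simp only: functional_add[OF linear_row] functional_diff[OF linear_row]
        functional_cmult[OF linear_row] functional_multc[OF linear_row] row_const)
  also have "row_mean m ?Q = ?p'" by (simp only: row_quadratic trace)
  also have "row_mean m ?R = ?q'" by (simp only: row_quadratic trace)
  also have "row_mean m (\<lambda>x. ?Q x * ?R x)
      = ?p' * ?q' + (\<Sum>i<m. \<Sum>j<m. ?B i j * ?C i j) + ?T + (b - 3) * ?D"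
    by (simp only: row_quadratic_prod trace)
  \<comment> \<open>Symmetry merges two of the contractions, which is the origin of the factor
    2.\<close>
  also have "(\<Sum>i<m. \<Sum>j<m. ?B i j * ?C i j) = ?T"
    using adj_char_sym[OF S sym] by (intro sum.cong refl) auto
  finally have *: "row_mean m (\<lambda>x. (?p - ?Q x) * (?q - ?R x))
      = ?p * ?q - ?p' * ?q - ?p * ?q' + (?p' * ?q' + ?T + ?T + (b - 3) * ?D)" .
  have T: "(\<nu> - \<mu>) * ?T = ?p' * ?q - ?p * ?q'"
    using adj_char_resolvent[OF S, of \<nu> \<mu>] unfolding trace by (simp add: mult.commute)
  have D: "?D = (\<Sum>a<m. poly (char_poly (mat_delete S a a)) \<mu>
        * poly (char_poly (mat_delete S a a)) \<nu>)"
    by (intro sum.cong refl) (simp add: adj_char_diag[OF S])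
  have "(\<nu> - \<mu>) * row_mean m (\<lambda>x. (?p - ?Q x) * (?q - ?R x))
      = (\<nu> - \<mu>) * (?p * ?q - ?p' * ?q - ?p * ?q' + ?p' * ?q')
        + 2 * ((\<nu> - \<mu>) * ?T) + (\<nu> - \<mu>) * (b - 3) * ?D"
    unfolding * by (simp add: algebra_simps)
  thus ?thesis unfolding T D char_poly_rank_one_update[OF S] .
qed

text \<open>A principal minor of a Gram matrix is the Gram matrix of the array without column
  \<open>a\<close>, so its mean is that of an array with \<open>m\<close> columns.\<close>

lemma corr_minor:
  assumes a: "a \<le> m"
  shows "array_mean n (Suc m) (\<lambda>X. poly (char_poly (mat_delete (gram n (Suc m) X) a a)) \<mu>
      * poly (char_poly (mat_delete (gram n (Suc m) X) a a)) \<nu>) = corr n m \<mu> \<nu>"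
  unfolding corr_def mat_delete_gram
  by (rule iterate_functional_skip_column[OF linear moment_0 _ a,
        where F = "\<lambda>X. poly (char_poly (gram n m X)) \<mu> * poly (char_poly (gram n m X)) \<nu>"])
     (simp cong: gram_cong)

lemma corr_0: "corr 0 m \<mu> \<nu> = (\<mu> * \<nu>) ^ m"
proof -
  have "poly (char_poly (gram 0 m X)) z = z ^ m" for z and X :: "nat \<Rightarrow> nat \<Rightarrow> complex"
  proof -
    have "poly (char_poly (gram 0 m X)) z = Determinant.det (z \<cdot>\<^sub>m 1\<^sub>m m)"
      unfolding char_poly_def
      by (rule poly_det_cong[of _ m]) (auto simp: char_poly_matrix_def gram_def)
    thus ?thesis by simp
  qed
  thus ?thesis by (simp add: corr_def power_mult_distrib)
qed

text \<open>The factor \<open>\<nu> - \<mu>\<close> is kept, since division by it would lose the case \<open>\<mu> = \<nu>\<close>.\<close>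

lemma corr_Suc:
  defines "P \<equiv> \<lambda>n m X. char_poly (gram n m X)"
  shows "(\<nu> - \<mu>) * corr (Suc n) m \<mu> \<nu>
    = (\<nu> - \<mu>) * (corr n m \<mu> \<nu>
        - array_mean n m (\<lambda>X. poly (pderiv (P n m X)) \<mu> * poly (P n m X) \<nu>)
        - array_mean n m (\<lambda>X. poly (P n m X) \<mu> * poly (pderiv (P n m X)) \<nu>)
        + array_mean n m (\<lambda>X. poly (pderiv (P n m X)) \<mu> * poly (pderiv (P n m X)) \<nu>))
    + 2 * (array_mean n m (\<lambda>X. poly (pderiv (P n m X)) \<mu> * poly (P n m X) \<nu>)
        - array_mean n m (\<lambda>X. poly (P n m X) \<mu> * poly (pderiv (P n m X)) \<nu>))
    + (\<nu> - \<mu>) * (b - 3) * (of_nat m * corr n (m - 1) \<mu> \<nu>)"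
proof -
  \<comment> \<open>For \<open>m = 0\<close> the truncated \<open>m - 1\<close> is harmless: the sum
    is empty and the factor \<open>of_nat m\<close> vanishes.\<close>
  have minors: "array_mean n m (\<lambda>X. \<Sum>a<m. poly (char_poly (mat_delete (gram n m X) a a)) \<mu>
        * poly (char_poly (mat_delete (gram n m X) a a)) \<nu>) = of_nat m * corr n (m - 1) \<mu> \<nu>"
  proof (cases m)
    case (Suc m')
    show ?thesis unfolding Suc functional_sum[OF linear_array] by (simp add: corr_minor)
  qed (simp add: functional_zero[OF linear_array])
  have "(\<nu> - \<mu>) * corr (Suc n) m \<mu> \<nu> = array_mean n m (\<lambda>X. (\<nu> - \<mu>) * row_mean m (\<lambda>x.
      poly (char_poly (gram n m X + Matrix.mat m m (\<lambda>(i, j). x i * x j))) \<mu> *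
      poly (char_poly (gram n m X + Matrix.mat m m (\<lambda>(i, j). x i * x j))) \<nu>))"
    unfolding corr_def iterate_functional.simps gram_Suc functional_cmult[OF linear_array] ..
  also have "\<dots> = (\<nu> - \<mu>) * (corr n m \<mu> \<nu>
        - array_mean n m (\<lambda>X. poly (pderiv (P n m X)) \<mu> * poly (P n m X) \<nu>)
        - array_mean n m (\<lambda>X. poly (P n m X) \<mu> * poly (pderiv (P n m X)) \<nu>)
        + array_mean n m (\<lambda>X. poly (pderiv (P n m X)) \<mu> * poly (pderiv (P n m X)) \<nu>))
    + 2 * (array_mean n m (\<lambda>X. poly (pderiv (P n m X)) \<mu> * poly (P n m X) \<nu>)
        - array_mean n m (\<lambda>X. poly (P n m X) \<mu> * poly (pderiv (P n m X)) \<nu>))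
    + (\<nu> - \<mu>) * (b - 3) * (of_nat m * corr n (m - 1) \<mu> \<nu>)"
    unfolding row_step[OF gram_carrier transpose_gram] minors[symmetric] P_def
    unfolding corr_def
    by (simp only: functional_add[OF linear_array] functional_diff[OF linear_array]
        functional_cmult[OF linear_array])
  finally show ?thesis .
qed

end

section \<open>Solution of the recursion\<close>

lemma poly_as_bounded_sum:
  fixes p :: "'a :: comm_semiring_1 poly"
  assumes "degree p \<le> m"
  shows "poly p x = (\<Sum>i\<le>m. coeff p i * x ^ i)"
  unfolding poly_altdef
  by (rule sum.mono_neutral_left) (use assms in \<open>auto simp: coeff_eq_0\<close>)

text \<open>The degree bound reduces the claim to finitely many coefficients, through which a merely
  linear functional commutes with differentiation.\<close>

lemma functional_poly_derivative:
  assumes E: "linear_functional E" and deg: "\<And>X. degree (p X) \<le> m"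
  shows "((\<lambda>\<mu>. E (\<lambda>X. poly (p X) \<mu> * c X)) has_field_derivative
    E (\<lambda>X. poly (pderiv (p X)) \<mu> * c X)) (at \<mu>)"
proof -
  let ?e = "\<lambda>i. E (\<lambda>X. coeff (p X) i * c X)"
  have pull: "E (\<lambda>X. (\<Sum>i\<le>m. coeff (p X) i * w i) * c X) = (\<Sum>i\<le>m. ?e i * w i)" for w
  proof -
    have "E (\<lambda>X. (\<Sum>i\<le>m. coeff (p X) i * w i) * c X) = E (\<lambda>X. \<Sum>i\<le>m. (coeff (p X) i * c X) * w i)"
      unfolding sum_distrib_right by (simp only: mult_ac)
    thus ?thesis by (simp only: functional_sum[OF E] functional_multc[OF E])
  qed
  have deriv: "((\<lambda>z. \<Sum>i\<le>m. e i * z ^ i) has_field_derivative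
      (\<Sum>i\<le>m. e i * (of_nat i * z ^ (i - 1)))) (at z)" for e :: "nat \<Rightarrow> complex" and z
    by (auto intro!: derivative_eq_intros sum.cong)
  have "poly (pderiv (p X)) z = (\<Sum>i\<le>m. coeff (p X) i * (of_nat i * z ^ (i - 1)))" for X z
    by (rule DERIV_unique[OF poly_DERIV])
       (use deriv[of "coeff (p X)" z] in \<open>simp add: poly_as_bounded_sum[OF deg]\<close>)
  hence "E (\<lambda>X. poly (pderiv (p X)) \<mu> * c X) = (\<Sum>i\<le>m. ?e i * (of_nat i * \<mu> ^ (i - 1)))"
    by (simp only: pull)
  moreover have "(\<lambda>\<mu>. E (\<lambda>X. poly (p X) \<mu> * c X)) = (\<lambda>\<mu>. \<Sum>i\<le>m. ?e i * \<mu> ^ i)"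
    by (simp only: poly_as_bounded_sum[OF deg] pull)
  ultimately show ?thesis using deriv[of ?e \<mu>] by simp
qed

section \<open>Bivariate polynomials in divided powers\<close>

definition divpow :: "complex \<Rightarrow> nat \<Rightarrow> complex" where
  "divpow x k = x ^ k / fact k"

lemma divpow_0 [simp]: "divpow x 0 = 1"
  by (simp add: divpow_def)

lemma mult_divpow: "x * divpow x k = of_nat (Suc k) * divpow x (Suc k)"
  by (simp add: divpow_def field_simps del: of_nat_Suc)

lemma DERIV_divpow:
  assumes "(f has_field_derivative f') (at x)"
  shows "((\<lambda>x. divpow (f x) k) has_field_derivative f' * (if k = 0 then 0 else divpow (f x) (k - 1))) (at x)"
proof (cases k)
  case (Suc j)
  have "((\<lambda>x. f x ^ Suc j / fact (Suc j)) has_field_derivative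
      (1 + of_nat j) * (f' * f x ^ j) / fact (Suc j)) (at x)"
    by (intro DERIV_cdivide DERIV_power_Suc assms)
  moreover have "1 + of_nat j \<noteq> (0 :: complex)"
    using of_nat_neq_0[of j, where 'a = complex] by simp
  ultimately show ?thesis by (simp add: Suc divpow_def)
qed simp

text \<open>In divided powers the partial derivatives are index shifts of \<open>A\<close>. For
  arrays supported on \<open>k + i \<le> m\<close> (\<open>triangular\<close>), the square range of
  summation loses nothing under these shifts.\<close>

definition bisum :: "nat \<Rightarrow> (nat \<Rightarrow> nat \<Rightarrow> complex) \<Rightarrow> complex \<Rightarrow> complex \<Rightarrow> complex" where
  "bisum m A q t = (\<Sum>k\<le>m. \<Sum>i\<le>m. A k i * divpow q k * divpow t i)"

definition triangular :: "nat \<Rightarrow> (nat \<Rightarrow> nat \<Rightarrow> complex) \<Rightarrow> bool" where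
  "triangular m A \<longleftrightarrow> (\<forall>k i. m < k + i \<longrightarrow> A k i = 0)"

lemma triangularD: "triangular m A \<Longrightarrow> m < k + i \<Longrightarrow> A k i = 0"
  by (simp add: triangular_def)

lemma bisum_swap: "bisum m A q t = bisum m (\<lambda>i k. A k i) t q"
  unfolding bisum_def by (subst sum.swap) (simp add: mult_ac)

lemma bisum_add: "bisum m (\<lambda>k i. A k i + B k i) q t = bisum m A q t + bisum m B q t"
  by (simp add: bisum_def sum.distrib algebra_simps)

lemma bisum_cmult: "bisum m (\<lambda>k i. c * A k i) q t = c * bisum m A q t"
  by (simp add: bisum_def sum_distrib_left mult_ac)

lemma bisum_extend:
  assumes "triangular m A" "m \<le> n"
  shows "bisum n A q t = bisum m A q t"
proof -
  have "bisum n A q t = (\<Sum>k\<le>m. \<Sum>i\<le>n. A k i * divpow q k * divpow t i)"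
    unfolding bisum_def using assms
    by (intro sum.mono_neutral_right) (auto intro!: sum.neutral simp: triangularD)
  also have "\<dots> = bisum m A q t"
    unfolding bisum_def using assms
    by (intro sum.cong refl sum.mono_neutral_right) (auto simp: triangularD)
  finally show ?thesis .
qed

lemma sum_atMost_shift_eq:
  fixes f g :: "nat \<Rightarrow> 'a :: comm_monoid_add"
  assumes "f 0 = 0" "g m = 0" "\<And>k. k < m \<Longrightarrow> f (Suc k) = g k"
  shows "(\<Sum>k\<le>m. f k) = (\<Sum>k\<le>m. g k)"
proof -
  have "(\<Sum>k\<le>m. f k) = (\<Sum>k<m. g k)"
    using assms by (simp add: sum.atMost_shift)
  also have "\<dots> = (\<Sum>k\<le>m. g k)"
    using assms(2) by (simp add: lessThan_Suc_atMost[symmetric])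
  finally show ?thesis .
qed

lemma bisum_shift:
  assumes "triangular m A"
  shows "(\<Sum>k\<le>m. \<Sum>i\<le>m. A k i * (if k = 0 then 0 else divpow q (k - 1)) * divpow t i)
    = bisum m (\<lambda>k i. A (Suc k) i) q t"
  unfolding bisum_def
  by (rule sum_atMost_shift_eq) (use assms in \<open>auto simp: triangularD\<close>)

text \<open>The Euler operator q d/dq multiplies the k-th divided power by k; triangularity removes
  the boundary term at \<open>k = m\<close>.\<close>

lemma bisum_mult:
  assumes "triangular m A"
  shows "q * bisum m (\<lambda>k i. A (Suc k) i) q t = bisum m (\<lambda>k i. of_nat k * A k i) q t"
  unfolding bisum_def sum_distrib_left
proof (rule sum_atMost_shift_eq[symmetric], goal_cases)
  case (3 k)
  have "q * (A (Suc k) i * divpow q k * divpow t i)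
      = of_nat (Suc k) * A (Suc k) i * divpow q (Suc k) * divpow t i" for i
    using mult_divpow[of q k] by (simp add: algebra_simps del: of_nat_Suc)
  thus ?case by (simp only:)
qed (use assms in \<open>auto simp: triangularD\<close>)

lemma bisum_mult_right:
  assumes "triangular m A"
  shows "t * bisum m (\<lambda>k i. A k (Suc i)) q t = bisum m (\<lambda>k i. of_nat i * A k i) q t"
  using bisum_mult[of m "\<lambda>i k. A k i" t q] assms
  by (simp add: bisum_swap[of m _ q t] triangular_def add.commute)

lemma DERIV_bisum:
  assumes A: "triangular m A"
    and Q: "(Q has_field_derivative Q') (at x)" and T: "(T has_field_derivative T') (at x)"
  shows "((\<lambda>x. bisum m A (Q x) (T x)) has_field_derivative
    Q' * bisum m (\<lambda>k i. A (Suc k) i) (Q x) (T x) + T' * bisum m (\<lambda>k i. A k (Suc i)) (Q x) (T x)) (at x)"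
proof -
  let ?d = "\<lambda>x k. if k = 0 then 0 else divpow x (k - 1)"
  have "((\<lambda>x. bisum m A (Q x) (T x)) has_field_derivative
    (\<Sum>k\<le>m. \<Sum>i\<le>m. Q' * (A k i * ?d (Q x) k * divpow (T x) i)
      + T' * (A k i * divpow (Q x) k * ?d (T x) i))) (at x)"
    unfolding bisum_def
    by (auto intro!: derivative_eq_intros DERIV_divpow Q T sum.cong simp: algebra_simps)
  also have "(\<Sum>k\<le>m. \<Sum>i\<le>m. Q' * (A k i * ?d (Q x) k * divpow (T x) i)
      + T' * (A k i * divpow (Q x) k * ?d (T x) i))
    = Q' * (\<Sum>k\<le>m. \<Sum>i\<le>m. A k i * ?d (Q x) k * divpow (T x) i)
    + T' * (\<Sum>k\<le>m. \<Sum>i\<le>m. A k i * divpow (Q x) k * ?d (T x) i)"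
    by (simp only: sum.distrib sum_distrib_left)
  also have "(\<Sum>k\<le>m. \<Sum>i\<le>m. A k i * ?d (Q x) k * divpow (T x) i)
      = bisum m (\<lambda>k i. A (Suc k) i) (Q x) (T x)"
    by (rule bisum_shift[OF A])
  also have "(\<Sum>k\<le>m. \<Sum>i\<le>m. A k i * divpow (Q x) k * ?d (T x) i)
      = (\<Sum>i\<le>m. \<Sum>k\<le>m. A k i * ?d (T x) i * divpow (Q x) k)"
    by (subst sum.swap) (simp only: mult_ac)
  also have "\<dots> = bisum m (\<lambda>i k. A k (Suc i)) (T x) (Q x)"
    by (rule bisum_shift) (use A in \<open>auto simp: triangular_def add.commute\<close>)
  also have "\<dots> = bisum m (\<lambda>k i. A k (Suc i)) (Q x) (T x)"
    by (rule bisum_swap)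
  finally show ?thesis .
qed

section \<open>Coefficients of the generating function and their recursion\<close>

text \<open>\<open>N choose (m - s)\<close>, but \<open>0\<close> when the subtraction would truncate.\<close>

definition descbinom :: "nat \<Rightarrow> nat \<Rightarrow> nat \<Rightarrow> complex" where
  "descbinom m N s = (if s \<le> m then of_nat (N choose (m - s)) else 0)"

lemma descbinom_Suc: "descbinom m (Suc N) s = descbinom m N s + descbinom m N (Suc s)"
proof (cases "s < m")
  case True
  then obtain r where "m = Suc (s + r)" using less_imp_Suc_add by auto
  thus ?thesis by (simp add: descbinom_def)
qed (auto simp: descbinom_def)

text \<open>The absorption identity r C(N, r) = (N - r + 1) C(N, r - 1) for r = m - s. Both sides
  vanish for \<open>s \<ge> m\<close>.\<close>

lemma descbinom_absorb:
  "(of_nat m - of_nat s) * descbinom m N s = (of_nat N + 1 - of_nat m + of_nat s) * descbinom m N (Suc s)"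
proof (cases "s < m")
  case True
  then obtain r where m: "m = Suc (s + r)" using less_imp_Suc_add by auto
  have "of_nat (Suc r) * of_nat (N choose Suc r) = (of_nat N - of_nat r) * (of_nat (N choose r) :: complex)"
  proof (cases "r \<le> N")
    case True
    have "Suc r * (N choose Suc r) = (N - r) * (N choose r)"
      by (metis binomial_absorb_comp binomial_absorption mult.commute)
    hence "of_nat (Suc r * (N choose Suc r)) = (of_nat ((N - r) * (N choose r)) :: complex)" by simp
    thus ?thesis using True by (simp only: of_nat_mult of_nat_diff)
  qed (simp add: binomial_eq_0)
  thus ?thesis by (simp add: descbinom_def m algebra_simps)
qed (auto simp: descbinom_def)

text \<open>
  The coefficient of \<open>x\<^sup>n y\<^sup>m q\<^sup>k t\<^sup>i / (k! i!)\<close> in \<open>(1 - x y)\<^sup>-\<^sup>3 exp ((x + q y + t x y) / (1 - x y))\<close>, where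
  \<open>q = \<mu> \<nu>\<close> and \<open>t = - (\<mu> + \<nu>)\<close>.
\<close>

definition gauss_coeff :: "nat \<Rightarrow> nat \<Rightarrow> nat \<Rightarrow> nat \<Rightarrow> complex" where
  "gauss_coeff n m k i =
    (if m \<le> n + k then descbinom m (n + k + 2) (k + i) / fact (n + k - m) else 0)"

text \<open>
  The operator \<open>(1 - \<partial>\<^sub>\<mu>) (1 - \<partial>\<^sub>\<nu>) + 2 (\<partial>\<^sub>\<mu> - \<partial>\<^sub>\<nu>) / (\<nu> - \<mu>)\<close> acting on the coefficients with respect to
  \<open>q\<^sup>k t\<^sup>i / (k! i!)\<close>. At \<open>i = 0\<close> the truncated index \<open>i - 1\<close> is harmless because of the factor \<open>i\<close>.
\<close>

definition row_operator :: "(nat \<Rightarrow> nat \<Rightarrow> complex) \<Rightarrow> nat \<Rightarrow> nat \<Rightarrow> complex" where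
  "row_operator A k i = A k i + 2 * A k (Suc i) + A k (Suc (Suc i))
    + of_nat i * A (Suc k) (i - 1) + (of_nat k + of_nat i + 3) * A (Suc k) i"

text \<open>This is the differential equation of the generating function in x, read off
  coefficientwise. Pascal's rule, applied twice, reduces every term to \<open>?X\<close> and
  \<open>?Y\<close>, and the remaining linear relation is \<open>descbinom_absorb\<close>.\<close>

lemma gauss_coeff_Suc:
  "of_nat (Suc n) * gauss_coeff (Suc n) m k i = row_operator (gauss_coeff n m) k i"
proof -
  let ?N = "n + k + 2" and ?s = "k + i"
  let ?X = "descbinom m (Suc ?N) ?s" and ?Y = "descbinom m (Suc ?N) (Suc ?s)"
  have absorb: "(of_nat m - of_nat ?s) * ?X = (of_nat (Suc ?N) + 1 - of_nat m + of_nat ?s) * ?Y"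
    by (rule descbinom_absorb)
  have left: "of_nat i * gauss_coeff n m (Suc k) (i - 1)
      = of_nat i * (if m \<le> Suc (n + k) then ?X / fact (Suc (n + k) - m) else 0)"
    by (cases i) (simp_all add: gauss_coeff_def)
  have right: "gauss_coeff n m (Suc k) i = (if m \<le> Suc (n + k) then ?Y / fact (Suc (n + k) - m) else 0)"
    by (simp add: gauss_coeff_def)
  have top: "gauss_coeff (Suc n) m k i = (if m \<le> Suc (n + k) then ?X / fact (Suc (n + k) - m) else 0)"
    by (simp add: gauss_coeff_def)
  \<comment> \<open>At \<open>m = Suc (n + k)\<close> the terms with index \<open>k\<close> on the
    right have vanished, while those with index \<open>Suc k\<close> survive with denominator
    0!.\<close>
  consider "m \<le> n + k" | "m = Suc (n + k)" | "m > Suc (n + k)" by linarith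
  thus ?thesis
  proof cases
    case 1
    \<comment> \<open>The ratio of the two factorials in the denominators.\<close>
    define J where "J = of_nat (Suc (n + k) - m) * (1 :: complex)"
    have J: "J = of_nat n + of_nat k + 1 - of_nat m" using 1 by (simp add: J_def of_nat_diff)
    have F: "fact (Suc (n + k) - m) = J * fact (n + k - m)"
      using 1 by (simp add: J_def Suc_diff_le)
    have J0: "J \<noteq> 0" unfolding J_def using 1 by (simp del: of_nat_diff)
    have low: "gauss_coeff n m k i + 2 * gauss_coeff n m k (Suc i) + gauss_coeff n m k (Suc (Suc i))
        = (?X + ?Y) / fact (n + k - m)"
      using 1 by (simp add: gauss_coeff_def descbinom_Suc add_divide_distrib)
    have "of_nat (Suc n) * ?X = J * (?X + ?Y) + of_nat i * ?X + (of_nat k + of_nat i + 3) * ?Y"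
      using absorb unfolding J by (simp add: algebra_simps)
    thus ?thesis
      unfolding row_operator_def low left right top using 1 J0
      by (simp add: F divide_simps)
  next
    case 2
    have "of_nat (Suc n) * ?X = of_nat i * ?X + (of_nat k + of_nat i + 3) * ?Y"
      using absorb unfolding 2 by (simp add: algebra_simps)
    moreover have "gauss_coeff n m k j = 0" for j using 2 by (simp add: gauss_coeff_def)
    ultimately show ?thesis
      unfolding row_operator_def left right top by (simp add: 2)
  next
    case 3
    thus ?thesis unfolding row_operator_def left by (simp add: gauss_coeff_def)
  qed
qed

lemma triangular_gauss_coeff: "triangular m (gauss_coeff n m)"
  by (auto simp: triangular_def gauss_coeff_def descbinom_def)

text \<open>Multiplication of the generating function by exp(c x y), which lowers \<open>n\<close>
  and \<open>m\<close> together; the guard \<open>l \<le> n\<close> prevents truncation in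
  \<open>n - l\<close>.\<close>

definition corr_coeff :: "complex \<Rightarrow> nat \<Rightarrow> nat \<Rightarrow> nat \<Rightarrow> nat \<Rightarrow> complex" where
  "corr_coeff c n m k i =
    (\<Sum>l\<le>m. if l \<le> n then divpow c l * gauss_coeff (n - l) (m - l) k i else 0)"

lemma triangular_corr_coeff: "triangular m (corr_coeff c n m)"
proof -
  have "gauss_coeff (n - l) (m - l) k i = 0" if "m < k + i" for l k i
    using that by (intro triangularD[OF triangular_gauss_coeff]) simp
  thus ?thesis by (auto simp: triangular_def corr_coeff_def intro!: sum.neutral)
qed

lemma corr_coeff_0: "corr_coeff c 0 m k i = (if k = m \<and> i = 0 then 1 else 0)"
proof -
  have "corr_coeff c 0 m k i = (\<Sum>l\<le>m. if l = 0 then gauss_coeff 0 m k i else 0)"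
    unfolding corr_coeff_def by (intro sum.cong) auto
  thus ?thesis by (auto simp: gauss_coeff_def descbinom_def)
qed

lemma row_operator_sum:
  "row_operator (\<lambda>k i. \<Sum>l\<in>I. w l * A l k i) k i = (\<Sum>l\<in>I. w l * row_operator (A l) k i)"
  by (simp add: row_operator_def sum.distrib sum_distrib_left algebra_simps)

text \<open>The product rule for the x-derivative: \<open>Suc n\<close> splits as
  \<open>(Suc n - l) + l\<close>. The first part uses the recursion of \<open>gauss_coeff\<close>,
  the second lowers the divided power of \<open>c\<close>.\<close>

lemma corr_coeff_Suc:
  "of_nat (Suc n) * corr_coeff c (Suc n) m k i = row_operator (corr_coeff c n m) k i
    + (if m = 0 then 0 else c * corr_coeff c n (m - 1) k i)"
proof -
  let ?g = "\<lambda>l. gauss_coeff (Suc n - l) (m - l) k i"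
  have "of_nat (Suc n) * corr_coeff c (Suc n) m k i
      = (\<Sum>l\<le>m. if l \<le> Suc n then of_nat (Suc n) * (divpow c l * ?g l) else 0)"
    unfolding corr_coeff_def sum_distrib_left by (intro sum.cong refl) simp
  \<comment> \<open>The first summand may be cut off at \<open>n\<close>, because its factor
    vanishes for \<open>l = Suc n\<close>.\<close>
  also have "\<dots> = (\<Sum>l\<le>m. (if l \<le> n then divpow c l * (of_nat (Suc n - l) * ?g l) else 0)
      + (if l \<le> Suc n then of_nat l * divpow c l * ?g l else 0))"
  proof (intro sum.cong refl, goal_cases)
    case (1 l)
    show ?case
    proof (cases "l \<le> Suc n")
      case True
      have "of_nat (Suc n) = of_nat (Suc n - l) + (of_nat l :: complex)"
        using True by (metis le_add_diff_inverse2 of_nat_add)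
      thus ?thesis using True
        by (cases "l \<le> n") (simp_all add: algebra_simps le_Suc_eq del: of_nat_Suc of_nat_diff)
    qed simp
  qed
  also have "\<dots> = (\<Sum>l\<le>m. if l \<le> n then divpow c l * (of_nat (Suc n - l) * ?g l) else 0)
      + (\<Sum>l\<le>m. if l \<le> Suc n then of_nat l * divpow c l * ?g l else 0)"
    by (rule sum.distrib)
  also have "(\<Sum>l\<le>m. if l \<le> n then divpow c l * (of_nat (Suc n - l) * ?g l) else 0)
      = (\<Sum>l\<le>m. (if l \<le> n then divpow c l else 0) * row_operator (gauss_coeff (n - l) (m - l)) k i)"
    by (intro sum.cong refl) (auto simp: gauss_coeff_Suc[symmetric] Suc_diff_le simp del: of_nat_Suc)
  also have "\<dots> = row_operator (corr_coeff c n m) k i"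
    unfolding row_operator_sum[symmetric] corr_coeff_def
    by (intro arg_cong[where f = "\<lambda>A. row_operator A k i"] ext sum.cong) auto
  also have "(\<Sum>l\<le>m. if l \<le> Suc n then of_nat l * divpow c l * ?g l else 0)
      = (if m = 0 then 0 else c * corr_coeff c n (m - 1) k i)"
  proof (cases m)
    case (Suc m')
    have "(\<Sum>l\<le>m. if l \<le> Suc n then of_nat l * divpow c l * ?g l else 0)
        = (\<Sum>l\<le>m'. if l \<le> n then c * (divpow c l * gauss_coeff (n - l) (m' - l) k i) else 0)"
      unfolding Suc sum.atMost_Suc_shift
      by (simp add: mult_divpow[symmetric] mult.assoc del: of_nat_Suc cong: if_cong)
    thus ?thesis
      by (simp add: Suc corr_coeff_def sum_distrib_left if_distrib[of "\<lambda>x. c * x"] cong: if_cong)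
  qed simp
  finally show ?thesis .
qed

section \<open>Symmetric polynomials in the two spectral parameters\<close>

definition symsum :: "nat \<Rightarrow> (nat \<Rightarrow> nat \<Rightarrow> complex) \<Rightarrow> complex \<Rightarrow> complex \<Rightarrow> complex" where
  "symsum m A \<mu> \<nu> = bisum m A (\<mu> * \<nu>) (- (\<mu> + \<nu>))"

lemma symsum_commute: "symsum m A \<mu> \<nu> = symsum m A \<nu> \<mu>"
  by (simp add: symsum_def mult.commute add.commute)

lemma DERIV_symsum:
  assumes "triangular m A"
  shows "((\<lambda>\<mu>. symsum m A \<mu> \<nu>) has_field_derivative
    \<nu> * symsum m (\<lambda>k i. A (Suc k) i) \<mu> \<nu> - symsum m (\<lambda>k i. A k (Suc i)) \<mu> \<nu>) (at \<mu>)"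
proof -
  have "((\<lambda>\<mu>. \<mu> * \<nu>) has_field_derivative \<nu>) (at \<mu>)"
    and "((\<lambda>\<mu>. - (\<mu> + \<nu>)) has_field_derivative - 1) (at \<mu>)"
    by (auto intro!: derivative_eq_intros)
  from DERIV_bisum[OF assms this] show ?thesis by (simp add: symsum_def)
qed

lemma DERIV_symsum_right:
  assumes "triangular m A"
  shows "((\<lambda>\<nu>. symsum m A \<mu> \<nu>) has_field_derivative
    \<mu> * symsum m (\<lambda>k i. A (Suc k) i) \<mu> \<nu> - symsum m (\<lambda>k i. A k (Suc i)) \<mu> \<nu>) (at \<nu>)"
  using DERIV_symsum[OF assms, where \<mu> = \<nu> and \<nu> = \<mu>] by (simp only: symsum_commute[of m _ \<nu> \<mu>] symsum_commute[of m A _ \<mu>])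

text \<open>With d/d\<mu> = \<nu> d/dq - d/dt and its mirror image, the quotient of (d/d\<mu> -
  d/d\<nu>) by \<nu> - \<mu> is simply d/dq, and the mixed derivative is d/dq + q (d/dq)^2 + t
  (d/dq)(d/dt) + (d/dt)^2. The Euler operators turn these into \<open>row_operator\<close>.\<close>

lemma symsum_row_operator:
  fixes \<mu> \<nu> :: complex
  assumes A: "triangular m A"
  defines "A\<^sub>q \<equiv> \<lambda>k i. A (Suc k) i" and "A\<^sub>t \<equiv> \<lambda>k i. A k (Suc i)"
    and "q \<equiv> \<mu> * \<nu>" and "t \<equiv> - (\<mu> + \<nu>)"
  shows "symsum m (row_operator A) \<mu> \<nu> = symsum m A \<mu> \<nu> + t * symsum m A\<^sub>q \<mu> \<nu> + 2 * symsum m A\<^sub>t \<mu> \<nu>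
    + (symsum m A\<^sub>q \<mu> \<nu> + q * symsum m (\<lambda>k i. A\<^sub>q (Suc k) i) \<mu> \<nu>
      + t * symsum m (\<lambda>k i. A\<^sub>q k (Suc i)) \<mu> \<nu> + symsum m (\<lambda>k i. A\<^sub>t k (Suc i)) \<mu> \<nu>)
    + 2 * symsum m A\<^sub>q \<mu> \<nu>"
proof -
  have Aq: "triangular m A\<^sub>q" using A by (auto simp: triangular_def A\<^sub>q_def)
  \<comment> \<open>One index is raised and the other lowered, so the total degree is kept and
    multiplication by \<open>t\<close> falls under \<open>bisum_mult_right\<close>.\<close>
  have Ar: "triangular m (\<lambda>k i. if i = 0 then 0 else A (Suc k) (i - 1))"
    using A by (auto simp: triangular_def)
  have "t * bisum m A\<^sub>q q t = bisum m (\<lambda>k i. of_nat i * A (Suc k) (i - 1)) q t"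
    using bisum_mult_right[OF Ar, of t q]
    by (simp add: A\<^sub>q_def if_distrib[of "\<lambda>x. _ * x"] cong: if_cong)
       (simp add: bisum_def, intro sum.cong, auto)
  moreover have "q * bisum m (\<lambda>k i. A\<^sub>q (Suc k) i) q t = bisum m (\<lambda>k i. of_nat k * A\<^sub>q k i) q t"
    by (rule bisum_mult[OF Aq])
  moreover have "t * bisum m (\<lambda>k i. A\<^sub>q k (Suc i)) q t = bisum m (\<lambda>k i. of_nat i * A\<^sub>q k i) q t"
    by (rule bisum_mult_right[OF Aq])
  moreover have "bisum m (row_operator A) q t = bisum m (\<lambda>k i. A k i + 2 * A\<^sub>t k i + A\<^sub>t k (Suc i)
      + of_nat i * A (Suc k) (i - 1) + (of_nat k * A\<^sub>q k i + of_nat i * A\<^sub>q k i + 3 * A\<^sub>q k i)) q t"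
    by (simp add: row_operator_def[abs_def] A\<^sub>q_def A\<^sub>t_def algebra_simps)
  ultimately show ?thesis
    unfolding symsum_def q_def[symmetric] t_def[symmetric]
    by (simp only: bisum_add bisum_cmult) (simp add: algebra_simps)
qed

text \<open>The claimed closed form of \<open>corr\<close> for \<open>c = b - 3\<close>; the
  factorials undo the exponential normalisation in x and y.\<close>

definition corr_poly :: "complex \<Rightarrow> nat \<Rightarrow> nat \<Rightarrow> complex \<Rightarrow> complex \<Rightarrow> complex" where
  "corr_poly c n m \<mu> \<nu> = fact n * fact m * symsum m (corr_coeff c n m) \<mu> \<nu>"

lemma corr_poly_0: "corr_poly c 0 m \<mu> \<nu> = (\<mu> * \<nu>) ^ m"
proof -
  have "symsum m (corr_coeff c 0 m) \<mu> \<nu>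
      = (\<Sum>k\<le>m. \<Sum>i\<le>m. if i = 0 then (if k = m then divpow (\<mu> * \<nu>) k else 0) else 0)"
    unfolding symsum_def bisum_def by (intro sum.cong refl) (simp add: corr_coeff_0)
  also have "\<dots> = divpow (\<mu> * \<nu>) m" by simp
  finally show ?thesis by (simp add: corr_poly_def divpow_def)
qed

text \<open>The bracketed terms are the derivatives computed in \<open>DERIV_corr_poly\<close>, and
  \<open>2 * (C * S\<^sub>q)\<close> is the quotient term, so this has the shape of the recursion
  for \<open>corr\<close>.\<close>

lemma corr_poly_Suc:
  fixes c \<mu> \<nu> :: complex and n m :: nat
  defines "A \<equiv> corr_coeff c n m" and "C \<equiv> fact n * fact m :: complex"
  defines "S\<^sub>q \<equiv> symsum m (\<lambda>k i. A (Suc k) i) \<mu> \<nu>" and "S\<^sub>t \<equiv> symsum m (\<lambda>k i. A k (Suc i)) \<mu> \<nu>"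
  shows "corr_poly c (Suc n) m \<mu> \<nu> = corr_poly c n m \<mu> \<nu>
      - C * (\<nu> * S\<^sub>q - S\<^sub>t) - C * (\<mu> * S\<^sub>q - S\<^sub>t)
      + C * (S\<^sub>q + \<nu> * (\<mu> * symsum m (\<lambda>k i. A (Suc (Suc k)) i) \<mu> \<nu>
          - symsum m (\<lambda>k i. A (Suc k) (Suc i)) \<mu> \<nu>)
        - (\<mu> * symsum m (\<lambda>k i. A (Suc k) (Suc i)) \<mu> \<nu> - symsum m (\<lambda>k i. A k (Suc (Suc i))) \<mu> \<nu>))
      + 2 * (C * S\<^sub>q) + c * (of_nat m * corr_poly c n (m - 1) \<mu> \<nu>)"
proof -
  have "(\<lambda>k i. of_nat (Suc n) * corr_coeff c (Suc n) m k i)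
      = (\<lambda>k i. row_operator A k i + (if m = 0 then 0 else c) * corr_coeff c n (m - 1) k i)"
    by (auto simp: fun_eq_iff corr_coeff_Suc A_def simp del: of_nat_Suc)
  hence "of_nat (Suc n) * symsum m (corr_coeff c (Suc n) m) \<mu> \<nu>
      = symsum m (row_operator A) \<mu> \<nu> + (if m = 0 then 0 else c) * symsum m (corr_coeff c n (m - 1)) \<mu> \<nu>"
    unfolding symsum_def bisum_cmult[symmetric] by (simp only: bisum_add)
  moreover have "symsum m (corr_coeff c n (m - 1)) \<mu> \<nu> = symsum (m - 1) (corr_coeff c n (m - 1)) \<mu> \<nu>"
    unfolding symsum_def by (rule bisum_extend[OF triangular_corr_coeff]) simp
  ultimately have "corr_poly c (Suc n) m \<mu> \<nu> = C * symsum m (row_operator A) \<mu> \<nu>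
      + C * ((if m = 0 then 0 else c) * symsum (m - 1) (corr_coeff c n (m - 1)) \<mu> \<nu>)"
    by (simp add: corr_poly_def C_def distrib_left[symmetric] mult_ac)
  also have "C * ((if m = 0 then 0 else c) * symsum (m - 1) (corr_coeff c n (m - 1)) \<mu> \<nu>)
      = c * (of_nat m * corr_poly c n (m - 1) \<mu> \<nu>)"
    by (cases m) (simp_all add: corr_poly_def C_def)
  also have "C * symsum m (row_operator A) \<mu> \<nu> = corr_poly c n m \<mu> \<nu>
      - C * (\<nu> * S\<^sub>q - S\<^sub>t) - C * (\<mu> * S\<^sub>q - S\<^sub>t)
      + C * (S\<^sub>q + \<nu> * (\<mu> * symsum m (\<lambda>k i. A (Suc (Suc k)) i) \<mu> \<nu>
          - symsum m (\<lambda>k i. A (Suc k) (Suc i)) \<mu> \<nu>)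
        - (\<mu> * symsum m (\<lambda>k i. A (Suc k) (Suc i)) \<mu> \<nu> - symsum m (\<lambda>k i. A k (Suc (Suc i))) \<mu> \<nu>))
      + 2 * (C * S\<^sub>q)"
    unfolding symsum_row_operator[OF triangular_corr_coeff, of m c n \<mu> \<nu>, folded A_def]
    by (simp add: corr_poly_def A_def[symmetric] C_def[symmetric] S\<^sub>q_def[symmetric] S\<^sub>t_def[symmetric])
       (simp add: algebra_simps)
  finally show ?thesis .
qed

lemma DERIV_corr_poly:
  fixes c \<mu> \<nu> :: complex and n m :: nat
  defines "A \<equiv> corr_coeff c n m" and "C \<equiv> fact n * fact m :: complex"
  shows "((\<lambda>\<mu>. corr_poly c n m \<mu> \<nu>) has_field_derivative
      C * (\<nu> * symsum m (\<lambda>k i. A (Suc k) i) \<mu> \<nu> - symsum m (\<lambda>k i. A k (Suc i)) \<mu> \<nu>)) (at \<mu>)"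
    and "((\<lambda>\<nu>. corr_poly c n m \<mu> \<nu>) has_field_derivative
      C * (\<mu> * symsum m (\<lambda>k i. A (Suc k) i) \<mu> \<nu> - symsum m (\<lambda>k i. A k (Suc i)) \<mu> \<nu>)) (at \<nu>)"
    and "((\<lambda>\<nu>. C * (\<nu> * symsum m (\<lambda>k i. A (Suc k) i) \<mu> \<nu> - symsum m (\<lambda>k i. A k (Suc i)) \<mu> \<nu>))
      has_field_derivative
      C * (symsum m (\<lambda>k i. A (Suc k) i) \<mu> \<nu> + \<nu> * (\<mu> * symsum m (\<lambda>k i. A (Suc (Suc k)) i) \<mu> \<nu>
          - symsum m (\<lambda>k i. A (Suc k) (Suc i)) \<mu> \<nu>)
        - (\<mu> * symsum m (\<lambda>k i. A (Suc k) (Suc i)) \<mu> \<nu> - symsum m (\<lambda>k i. A k (Suc (Suc i))) \<mu> \<nu>)))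
      (at \<nu>)"
proof -
  have A: "triangular m A" unfolding A_def by (rule triangular_corr_coeff)
  show "((\<lambda>\<mu>. corr_poly c n m \<mu> \<nu>) has_field_derivative
      C * (\<nu> * symsum m (\<lambda>k i. A (Suc k) i) \<mu> \<nu> - symsum m (\<lambda>k i. A k (Suc i)) \<mu> \<nu>)) (at \<mu>)"
    unfolding corr_poly_def A_def[symmetric] C_def[symmetric]
    by (intro DERIV_cmult DERIV_symsum A)
  show "((\<lambda>\<nu>. corr_poly c n m \<mu> \<nu>) has_field_derivative
      C * (\<mu> * symsum m (\<lambda>k i. A (Suc k) i) \<mu> \<nu> - symsum m (\<lambda>k i. A k (Suc i)) \<mu> \<nu>)) (at \<nu>)"
    unfolding corr_poly_def A_def[symmetric] C_def[symmetric]
    by (intro DERIV_cmult DERIV_symsum_right A)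
  have "triangular m (\<lambda>k i. A (Suc k) i)" "triangular m (\<lambda>k i. A k (Suc i))"
    using A by (auto simp: triangular_def)
  note D = this[THEN DERIV_symsum_right]
  show "((\<lambda>\<nu>. C * (\<nu> * symsum m (\<lambda>k i. A (Suc k) i) \<mu> \<nu> - symsum m (\<lambda>k i. A k (Suc i)) \<mu> \<nu>))
      has_field_derivative
      C * (symsum m (\<lambda>k i. A (Suc k) i) \<mu> \<nu> + \<nu> * (\<mu> * symsum m (\<lambda>k i. A (Suc (Suc k)) i) \<mu> \<nu>
          - symsum m (\<lambda>k i. A (Suc k) (Suc i)) \<mu> \<nu>)
        - (\<mu> * symsum m (\<lambda>k i. A (Suc k) (Suc i)) \<mu> \<nu> - symsum m (\<lambda>k i. A k (Suc (Suc i))) \<mu> \<nu>)))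
      (at \<nu>)"
    by (auto intro!: derivative_eq_intros D)
qed

context moment_functional
begin

lemma DERIV_corr:
  defines "P \<equiv> \<lambda>n m X. char_poly (gram n m X)"
  shows "((\<lambda>\<mu>. corr n m \<mu> \<nu>) has_field_derivative
      array_mean n m (\<lambda>X. poly (pderiv (P n m X)) \<mu> * poly (P n m X) \<nu>)) (at \<mu>)"
    and "((\<lambda>\<nu>. corr n m \<mu> \<nu>) has_field_derivative
      array_mean n m (\<lambda>X. poly (P n m X) \<mu> * poly (pderiv (P n m X)) \<nu>)) (at \<nu>)"
    and "((\<lambda>\<nu>. array_mean n m (\<lambda>X. poly (pderiv (P n m X)) \<mu> * poly (P n m X) \<nu>)) has_field_derivative
      array_mean n m (\<lambda>X. poly (pderiv (P n m X)) \<mu> * poly (pderiv (P n m X)) \<nu>)) (at \<nu>)"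
proof -
  have deg: "degree (P n m X) \<le> m" for X
    using degree_monic_char_poly[OF gram_carrier[of n m X]] by (simp add: P_def)
  note D = functional_poly_derivative[OF linear_array, where p = "P n m", OF deg]
  have P: "char_poly (gram n m X) = P n m X" for X
    by (simp add: P_def)
  show "((\<lambda>\<mu>. corr n m \<mu> \<nu>) has_field_derivative
      array_mean n m (\<lambda>X. poly (pderiv (P n m X)) \<mu> * poly (P n m X) \<nu>)) (at \<mu>)"
    unfolding corr_def P by (rule D)
  show "((\<lambda>\<nu>. corr n m \<mu> \<nu>) has_field_derivative
      array_mean n m (\<lambda>X. poly (P n m X) \<mu> * poly (pderiv (P n m X)) \<nu>)) (at \<nu>)"
    unfolding corr_def P by (subst (1 2) mult.commute) (rule D)
  show "((\<lambda>\<nu>. array_mean n m (\<lambda>X. poly (pderiv (P n m X)) \<mu> * poly (P n m X) \<nu>)) has_field_derivative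
      array_mean n m (\<lambda>X. poly (pderiv (P n m X)) \<mu> * poly (pderiv (P n m X)) \<nu>)) (at \<nu>)"
    by (subst (1 2) mult.commute) (rule D)
qed

text \<open>The induction hypothesis holds for all parameters, so both functions also have the same
  derivatives by uniqueness. The recursions then agree up to the factor
  \<open>\<nu> - \<mu>\<close>, which cancels off the diagonal.\<close>

lemma corr_eq: "corr n m \<mu> \<nu> = corr_poly (b - 3) n m \<mu> \<nu>"
proof (induction n arbitrary: m \<mu> \<nu>)
  case 0
  show ?case by (simp add: corr_0 corr_poly_0)
next
  case (Suc n)
  note D = DERIV_corr(1,2)[where n = n and m = m, unfolded Suc.IH]
  have D1: "array_mean n m (\<lambda>X. poly (pderiv (char_poly (gram n m X))) \<mu> * poly (char_poly (gram n m X)) \<nu>)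
      = fact n * fact m * (\<nu> * symsum m (\<lambda>k i. corr_coeff (b - 3) n m (Suc k) i) \<mu> \<nu>
        - symsum m (\<lambda>k i. corr_coeff (b - 3) n m k (Suc i)) \<mu> \<nu>)" for \<mu> \<nu>
    by (rule DERIV_unique[OF D(1) DERIV_corr_poly(1)])
  have D2: "array_mean n m (\<lambda>X. poly (char_poly (gram n m X)) \<mu> * poly (pderiv (char_poly (gram n m X))) \<nu>)
      = fact n * fact m * (\<mu> * symsum m (\<lambda>k i. corr_coeff (b - 3) n m (Suc k) i) \<mu> \<nu>
        - symsum m (\<lambda>k i. corr_coeff (b - 3) n m k (Suc i)) \<mu> \<nu>)" for \<mu> \<nu>
    by (rule DERIV_unique[OF D(2) DERIV_corr_poly(2)])
  note D12 = DERIV_unique[OF DERIV_corr(3)[where n = n and m = m, unfolded D1] DERIV_corr_poly(3)]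
  have eq: "corr (Suc n) m \<mu> \<nu> = corr_poly (b - 3) (Suc n) m \<mu> \<nu>" if "\<mu> \<noteq> \<nu>" for \<mu> \<nu>
  proof -
    have "(\<nu> - \<mu>) * corr (Suc n) m \<mu> \<nu> = (\<nu> - \<mu>) * corr_poly (b - 3) (Suc n) m \<mu> \<nu>"
      unfolding corr_Suc[of \<nu> \<mu> n m] corr_poly_Suc D1 D2 D12 Suc.IH by (simp add: algebra_simps)
    thus ?thesis using that by simp
  qed
  show ?case
  proof (cases "\<mu> = \<nu>")
    case True
    \<comment> \<open>On the diagonal, continuity in the first parameter extends the
      equality.\<close>
    have "((\<lambda>\<mu>. corr (Suc n) m \<mu> \<nu>) \<longlongrightarrow> corr (Suc n) m \<nu> \<nu>) (at \<nu>)"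
      by (rule DERIV_isCont[OF DERIV_corr(1), THEN isContD])
    moreover have "((\<lambda>\<mu>. corr_poly (b - 3) (Suc n) m \<mu> \<nu>) \<longlongrightarrow> corr_poly (b - 3) (Suc n) m \<nu> \<nu>) (at \<nu>)"
      by (rule DERIV_isCont[OF DERIV_corr_poly(1), THEN isContD])
    hence "((\<lambda>\<mu>. corr (Suc n) m \<mu> \<nu>) \<longlongrightarrow> corr_poly (b - 3) (Suc n) m \<nu> \<nu>) (at \<nu>)"
      by (rule Lim_transform_eventually) (auto simp: eventually_at eq intro!: exI[of _ 1])
    ultimately show ?thesis unfolding True by (rule LIM_unique)
  qed (rule eq)
qed

end

section \<open>Summation of the generating function\<close>

lemma summable_real_neg_binomial:
  fixes y :: real
  assumes "\<bar>y\<bar> < 1"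
  shows "summable (\<lambda>r. real ((N + r) choose r) * y ^ r)"
proof -
  have "(- real (Suc N) gchoose r) * (- y) ^ r = real ((N + r) choose r) * y ^ r" for r
  proof -
    have "(- real (Suc N) gchoose r) = (- 1) ^ r * (real (N + r) gchoose r)"
      using gbinomial_minus[of "real (Suc N)" r] by simp
    thus ?thesis by (simp add: binomial_gbinomial power_minus[of y] mult_ac)
  qed
  thus ?thesis
    using gen_binomial_real[of "- y" "- real (Suc N)"] assms by (simp add: sums_iff)
qed

text \<open>Each step takes the Cauchy product with the geometric series; the coefficients add up by
  the hockey-stick identity.\<close>

lemma neg_binomial_sums:
  fixes x :: "'a :: {real_normed_field, banach}"
  assumes x: "norm x < 1"
  shows "(\<lambda>r. of_nat ((N + r) choose r) * x ^ r) sums (1 / (1 - x) ^ Suc N)"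
proof (induction N)
  case 0
  show ?case using geometric_sums[OF x] by (simp add: binomial_eq_0)
next
  case (Suc N)
  have "(\<Sum>i\<le>r. of_nat ((N + i) choose i) * x ^ i * x ^ (r - i)) = of_nat ((Suc N + r) choose r) * x ^ r" for r
  proof -
    have "(\<Sum>i\<le>r. of_nat ((N + i) choose i) * x ^ i * x ^ (r - i)) = (\<Sum>i\<le>r. of_nat ((N + i) choose i) * x ^ r)"
      by (intro sum.cong refl) (simp add: mult.assoc power_add[symmetric])
    also have "\<dots> = of_nat (\<Sum>i\<le>r. (N + i) choose i) * x ^ r" by (simp add: sum_distrib_right)
    finally show ?thesis by (simp add: sum_choose_lower)
  qed
  moreover have "summable (\<lambda>r. norm (of_nat ((N + r) choose r) * x ^ r))"
    using summable_real_neg_binomial[of "norm x" N] x by (simp add: norm_mult norm_power)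
  moreover have "summable (\<lambda>r. norm (x ^ r))"
    using x by (simp add: norm_power summable_geometric)
  ultimately have "(\<lambda>r. of_nat ((Suc N + r) choose r) * x ^ r) sums
      ((\<Sum>r. of_nat ((N + r) choose r) * x ^ r) * (\<Sum>r. x ^ r))"
    using Cauchy_product_sums[of "\<lambda>r. of_nat ((N + r) choose r) * x ^ r" "\<lambda>r. x ^ r"] by simp
  moreover have "(\<Sum>r. of_nat ((N + r) choose r) * x ^ r) = 1 / (1 - x) ^ Suc N"
    using Suc.IH by (rule sums_unique[symmetric])
  moreover have "(\<Sum>r. x ^ r) = 1 / (1 - x)" using x by (rule suminf_geometric)
  ultimately show ?case by (simp add: field_simps)
qed

lemma neg_binomial_has_sum:
  fixes x :: "'a :: {real_normed_field, banach}"
  assumes x: "norm x < 1"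
  shows "((\<lambda>r. of_nat ((N + r) choose r) * x ^ r) has_sum (1 / (1 - x) ^ Suc N)) UNIV"
  by (rule norm_summable_imp_has_sum[OF _ neg_binomial_sums[OF x]])
     (use summable_real_neg_binomial[of "norm x" N] x in \<open>simp add: norm_mult norm_power\<close>)

section \<open>The triple series and its regrouping\<close>

text \<open>The contribution of \<open>gauss_coeff (m + \<alpha>) m k i\<close> to the series, with
  \<open>r = m - k - i\<close> as a free index. It is polymorphic because the complex series is
  dominated by its real instance.\<close>

definition triple_term ::
  "nat \<Rightarrow> 'a \<Rightarrow> 'a \<Rightarrow> 'a \<Rightarrow> nat \<Rightarrow> nat \<Rightarrow> nat \<Rightarrow> 'a :: {real_normed_field, banach}" where
  "triple_term \<alpha> q t z k i r = q ^ k / (fact (k + \<alpha>) * fact k) * (t ^ i / fact i)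
    * (of_nat ((2 * k + i + \<alpha> + 2 + r) choose r) * z ^ (k + i + r))"

text \<open>Up to elementary factors, the terms of a modified Bessel series of order
  \<open>\<alpha>\<close> in q z / (1 - z)^2.\<close>

definition bessel_term :: "nat \<Rightarrow> 'a \<Rightarrow> 'a \<Rightarrow> nat \<Rightarrow> 'a :: {real_normed_field, banach}" where
  "bessel_term \<alpha> q z k = (q * z) ^ k / (fact (k + \<alpha>) * fact k) / (1 - z) ^ (2 * k + \<alpha> + 3)"

lemma triple_term_has_sum:
  assumes z: "norm z < 1"
  shows "((\<lambda>r. triple_term \<alpha> q t z k i r) has_sum bessel_term \<alpha> q z k * ((t * (z / (1 - z))) ^ i / fact i)) UNIV"
proof -
  have "Suc (2 * k + i + \<alpha> + 2) = (2 * k + \<alpha> + 3) + i" by simp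
  hence w: "(1 - z) ^ Suc (2 * k + i + \<alpha> + 2) = (1 - z) ^ (2 * k + \<alpha> + 3) * (1 - z) ^ i"
    by (simp only: power_add)
  have eq: "q ^ k / (fact (k + \<alpha>) * fact k) * (t ^ i / fact i) * z ^ (k + i) *
      (1 / (1 - z) ^ Suc (2 * k + i + \<alpha> + 2))
    = bessel_term \<alpha> q z k * ((t * (z / (1 - z))) ^ i / fact i)"
    unfolding w bessel_term_def power_mult_distrib power_divide power_add[of z k i]
    by (simp only: times_divide_eq_left times_divide_eq_right divide_divide_eq_left mult_1_right
        mult_1_left mult_ac)
  show ?thesis
    using has_sum_cmult_right[OF neg_binomial_has_sum[OF z, of "2 * k + i + \<alpha> + 2"],
        of "q ^ k / (fact (k + \<alpha>) * fact k) * (t ^ i / fact i) * z ^ (k + i)"]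
    unfolding eq by (simp add: triple_term_def power_add mult_ac)
qed

lemma exp_has_sum:
  fixes x :: "'a :: {real_normed_field, banach}"
  shows "((\<lambda>i. x ^ i / fact i) has_sum exp x) UNIV"
proof (rule norm_summable_imp_has_sum)
  show "summable (\<lambda>i. norm (x ^ i / fact i))"
    using summable_norm_exp[of x] by (simp add: divide_inverse scaleR_conv_of_real mult.commute norm_mult)
  show "(\<lambda>i. x ^ i / fact i) sums exp x"
    using exp_converges[of x] by (simp add: divide_inverse scaleR_conv_of_real mult.commute)
qed

text \<open>Since (k + \<alpha>)! \<ge> 1, an exponential series in |q z / (1 - z)^2|
  dominates.\<close>

lemma summable_norm_bessel_term:
  fixes q z :: "'a :: {real_normed_field, banach}"
  assumes z: "norm z < 1"
  shows "summable (\<lambda>k. norm (bessel_term \<alpha> q z k))"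
proof -
  let ?y = "norm (q * z / (1 - z) ^ 2)" and ?C = "norm (1 / (1 - z) ^ (\<alpha> + 3))"
  have z1: "1 - z \<noteq> 0" using z by auto
  have "summable (\<lambda>k. ?C * (?y ^ k / fact k))"
    by (intro summable_mult) (use summable_exp[of ?y] in \<open>simp add: divide_inverse mult.commute\<close>)
  moreover have "norm (norm (bessel_term \<alpha> q z k)) \<le> ?C * (?y ^ k / fact k)" for k
  proof -
    have "bessel_term \<alpha> q z k = (1 / (1 - z) ^ (\<alpha> + 3)) * ((q * z / (1 - z) ^ 2) ^ k / fact k) * (1 / fact (k + \<alpha>))"
    proof -
      have w: "(1 - z) ^ (2 * k + \<alpha> + 3) = ((1 - z) ^ 2) ^ k * (1 - z) ^ (\<alpha> + 3)"
        by (simp only: power_mult[symmetric] power_add[symmetric] add.assoc)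
      show ?thesis unfolding bessel_term_def w power_divide
        by (simp only: times_divide_eq_left times_divide_eq_right divide_divide_eq_left mult_1_right
            mult_1_left mult_ac)
    qed
    hence "norm (bessel_term \<alpha> q z k) = ?C * (?y ^ k / fact k) * (1 / fact (k + \<alpha>))"
      by (simp add: norm_mult norm_divide norm_power)
    also have "\<dots> \<le> ?C * (?y ^ k / fact k) * 1"
      by (intro mult_left_mono) (auto simp: fact_ge_1)
    finally show ?thesis by simp
  qed
  ultimately show ?thesis by (rule summable_comparison_test'[where N = 0])
qed

text \<open>All terms are nonnegative, so it suffices to sum successively over \<open>r\<close>,
  \<open>i\<close> and \<open>k\<close>.\<close>

lemma summable_on_triple_term_real:
  fixes q t z :: real
  assumes "0 \<le> q" "0 \<le> t" "0 \<le> z" "z < 1"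
  shows "(\<lambda>((k, i), r). triple_term \<alpha> q t z k i r) summable_on ((UNIV \<times> UNIV) \<times> UNIV)"
proof (rule summable_on_SigmaI)
  have z: "norm z < 1" using assms by simp
  show "((\<lambda>y. (\<lambda>((k, i), r). triple_term \<alpha> q t z k i r) (x, y)) has_sum
      (case x of (k, i) \<Rightarrow> bessel_term \<alpha> q z k * ((t * (z / (1 - z))) ^ i / fact i))) UNIV" for x
    using triple_term_has_sum[OF z] by (cases x) simp
  show "0 \<le> (\<lambda>((k, i), r). triple_term \<alpha> q t z k i r) (x, y)" for x y
    using assms by (cases x) (simp add: triple_term_def)
  show "(\<lambda>x. case x of (k, i) \<Rightarrow> bessel_term \<alpha> q z k * ((t * (z / (1 - z))) ^ i / fact i)) summable_on UNIV \<times> UNIV"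
  proof (rule summable_on_SigmaI)
    show "((\<lambda>y. case (x, y) of (k, i) \<Rightarrow> bessel_term \<alpha> q z k * ((t * (z / (1 - z))) ^ i / fact i)) has_sum
        bessel_term \<alpha> q z x * exp (t * (z / (1 - z)))) UNIV" for x
      using has_sum_cmult_right[OF exp_has_sum] by simp
    show "(\<lambda>x. bessel_term \<alpha> q z x * exp (t * (z / (1 - z)))) summable_on UNIV"
      by (intro summable_on_cmult_left norm_summable_imp_summable_on summable_norm_bessel_term z)
    show "0 \<le> (case (x, y) of (k, i) \<Rightarrow> bessel_term \<alpha> q z k * ((t * (z / (1 - z))) ^ i / fact i))" for x y
      using assms by (simp add: bessel_term_def)
  qed
qed

text \<open>The norm of a term is the term at the norms of the arguments, so the real case gives
  absolute summability and the iterated sums compute the value.\<close>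

lemma triple_term_total:
  fixes q t z :: complex
  assumes z: "norm z < 1"
  shows "((\<lambda>((k, i), r). triple_term \<alpha> q t z k i r) has_sum
    (\<Sum>k. bessel_term \<alpha> q z k) * exp (t * (z / (1 - z)))) ((UNIV \<times> UNIV) \<times> UNIV)"
proof -
  let ?f = "\<lambda>((k, i), r). triple_term \<alpha> q t z k i r"
  have "(\<lambda>p. norm (?f p)) = (\<lambda>((k, i), r). triple_term \<alpha> (norm q) (norm t) (norm z) k i r)"
    by (auto simp: fun_eq_iff triple_term_def norm_mult norm_divide norm_power)
  hence "(\<lambda>p. norm (?f p)) summable_on ((UNIV \<times> UNIV) \<times> UNIV)"
    using summable_on_triple_term_real[of "norm q" "norm t" "norm z" \<alpha>] z by simp
  hence "?f summable_on ((UNIV \<times> UNIV) \<times> UNIV)" by (rule Infinite_Sum.abs_summable_summable)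
  then obtain S where S: "(?f has_sum S) ((UNIV \<times> UNIV) \<times> UNIV)" by (auto simp: summable_on_def)
  have "((\<lambda>(k, i). bessel_term \<alpha> q z k * ((t * (z / (1 - z))) ^ i / fact i)) has_sum S) (UNIV \<times> UNIV)"
    by (rule has_sum_SigmaD[OF S]) (use triple_term_has_sum[OF z] in \<open>auto split: prod.splits\<close>)
  hence "((\<lambda>k. bessel_term \<alpha> q z k * exp (t * (z / (1 - z)))) has_sum S) UNIV"
    by (rule has_sum_SigmaD) (use has_sum_cmult_right[OF exp_has_sum] in auto)
  moreover have "((\<lambda>k. bessel_term \<alpha> q z k * exp (t * (z / (1 - z)))) has_sum
      (\<Sum>k. bessel_term \<alpha> q z k) * exp (t * (z / (1 - z)))) UNIV"
    by (rule has_sum_cmult_left, rule norm_summable_imp_has_sum,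
        rule summable_norm_bessel_term[OF z], rule summable_sums, rule summable_norm_cancel,
        rule summable_norm_bessel_term[OF z])
  ultimately have "S = (\<Sum>k. bessel_term \<alpha> q z k) * exp (t * (z / (1 - z)))" by (rule has_sum_unique)
  with S show ?thesis by simp
qed

lemma gauss_bisum_as_triple_sum:
  "bisum m (gauss_coeff (m + \<alpha>) m) q t * z ^ m
    = (\<Sum>(k, i)\<in>{(k, i). k + i \<le> m}. triple_term \<alpha> q t z k i (m - k - i))"
proof -
  let ?I = "{(k :: nat, i). k + i \<le> m}"
  have "bisum m (gauss_coeff (m + \<alpha>) m) q t * z ^ m
      = (\<Sum>(k, i)\<in>{..m} \<times> {..m}. gauss_coeff (m + \<alpha>) m k i * divpow q k * divpow t i * z ^ m)"
    by (simp add: bisum_def sum_distrib_right sum.cartesian_product case_prod_unfold)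
  also have "\<dots> = (\<Sum>(k, i)\<in>?I. gauss_coeff (m + \<alpha>) m k i * divpow q k * divpow t i * z ^ m)"
    by (intro sum.mono_neutral_right) (auto, metis not_le triangularD triangular_gauss_coeff)
  also have "\<dots> = (\<Sum>(k, i)\<in>?I. triple_term \<alpha> q t z k i (m - k - i))"
  proof (intro sum.cong refl, safe)
    fix k i assume "k + i \<le> m"
    moreover from this obtain r where "m = k + i + r" using le_Suc_ex by blast
    ultimately show "gauss_coeff (m + \<alpha>) m k i * divpow q k * divpow t i * z ^ m
        = triple_term \<alpha> q t z k i (m - k - i)"
      by (simp add: gauss_coeff_def descbinom_def triple_term_def divpow_def add_ac mult_2)
  qed
  finally show ?thesis .
qed

text \<open>The triple series is regrouped by the exponent \<open>m = k + i + r\<close> of z; each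
  group is finite.\<close>

lemma gauss_bisum_sums:
  fixes q t z :: complex
  assumes z: "norm z < 1"
  shows "(\<lambda>m. bisum m (gauss_coeff (m + \<alpha>) m) q t * z ^ m) sums
      ((\<Sum>k. bessel_term \<alpha> q z k) * exp (t * (z / (1 - z))))"
    and "summable (\<lambda>m. norm (bisum m (gauss_coeff (m + \<alpha>) m) q t * z ^ m))"
proof -
  let ?S = "(\<Sum>k. bessel_term \<alpha> q z k) * exp (t * (z / (1 - z)))"
  let ?I = "\<lambda>m. {(k :: nat, i). k + i \<le> m}"
  have "((\<lambda>(m, k, i). triple_term \<alpha> q t z k i (m - k - i)) has_sum ?S) (Sigma UNIV ?I)
      \<longleftrightarrow> ((\<lambda>((k, i), r). triple_term \<alpha> q t z k i r) has_sum ?S) ((UNIV \<times> UNIV) \<times> UNIV)"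
    by (rule has_sum_reindex_bij_witness[of _ "\<lambda>((k, i), r). (k + i + r, k, i)" "\<lambda>(m, k, i). ((k, i), m - k - i)"])
       auto
  hence S: "((\<lambda>(m, k, i). triple_term \<alpha> q t z k i (m - k - i)) has_sum ?S) (Sigma UNIV ?I)"
    using triple_term_total[OF z] by simp
  have fin: "finite (?I m)" for m
    by (rule finite_subset[of _ "{..m} \<times> {..m}"]) auto
  have "((\<lambda>m. \<Sum>(k, i)\<in>?I m. triple_term \<alpha> q t z k i (m - k - i)) has_sum ?S) UNIV"
    by (rule has_sum_SigmaD[OF S]) (use has_sum_finite[OF fin] in \<open>auto simp: case_prod_unfold\<close>)
  hence H: "((\<lambda>m. bisum m (gauss_coeff (m + \<alpha>) m) q t * z ^ m) has_sum ?S) UNIV"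
    by (simp only: gauss_bisum_as_triple_sum)
  thus "(\<lambda>m. bisum m (gauss_coeff (m + \<alpha>) m) q t * z ^ m) sums ?S" by (rule has_sum_imp_sums)
  have "(\<lambda>m. bisum m (gauss_coeff (m + \<alpha>) m) q t * z ^ m) summable_on UNIV"
    using H by (auto simp: summable_on_def)
  hence "(\<lambda>m. norm (bisum m (gauss_coeff (m + \<alpha>) m) q t * z ^ m)) summable_on UNIV"
    by (simp only: summable_on_iff_abs_summable_on_complex)
  thus "summable (\<lambda>m. norm (bisum m (gauss_coeff (m + \<alpha>) m) q t * z ^ m))"
    by (subst (asm) summable_on_UNIV_nonneg_real_iff) auto
qed

text \<open>The factor exp(c x y) preserves the difference of the exponents, so the convolution
  stays on the diagonal \<open>n = m + \<alpha>\<close>.\<close>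

lemma bisum_corr_coeff:
  "bisum m (corr_coeff c (m + \<alpha>) m) q t
    = (\<Sum>l\<le>m. divpow c l * bisum (m - l) (gauss_coeff (m - l + \<alpha>) (m - l)) q t)"
proof -
  have "bisum m (corr_coeff c (m + \<alpha>) m) q t
      = (\<Sum>k\<le>m. \<Sum>i\<le>m. \<Sum>l\<le>m. divpow c l * (gauss_coeff (m + \<alpha> - l) (m - l) k i * divpow q k * divpow t i))"
    unfolding bisum_def corr_coeff_def sum_distrib_right by (intro sum.cong refl) simp
  also have "\<dots> = (\<Sum>l\<le>m. \<Sum>k\<le>m. \<Sum>i\<le>m. divpow c l * (gauss_coeff (m + \<alpha> - l) (m - l) k i * divpow q k * divpow t i))"
    by (subst sum.swap[of _ _ "{..m}"], subst sum.swap) (rule refl)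
  also have "\<dots> = (\<Sum>l\<le>m. divpow c l * bisum m (gauss_coeff (m + \<alpha> - l) (m - l)) q t)"
    by (simp only: bisum_def sum_distrib_left)
  also have "\<dots> = (\<Sum>l\<le>m. divpow c l * bisum (m - l) (gauss_coeff (m - l + \<alpha>) (m - l)) q t)"
  proof (intro sum.cong refl)
    fix l assume "l \<in> {..m}"
    hence "m + \<alpha> - l = m - l + \<alpha>" by simp
    thus "divpow c l * bisum m (gauss_coeff (m + \<alpha> - l) (m - l)) q t
        = divpow c l * bisum (m - l) (gauss_coeff (m - l + \<alpha>) (m - l)) q t"
      by (simp only: bisum_extend[OF triangular_gauss_coeff, of "m - l" m] diff_le_self)
  qed
  finally show ?thesis .
qed

text \<open>On the diagonal that convolution is the Cauchy product of exp(c z) with the Gaussian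
  series.\<close>

lemma corr_poly_sums:
  fixes c \<mu> \<nu> z :: complex
  assumes z: "norm z < 1"
  shows "(\<lambda>m. corr_poly c (m + \<alpha>) m \<mu> \<nu> / (fact (m + \<alpha>) * fact m) * z ^ m) sums
    (exp (- (\<mu> + \<nu>) * (z / (1 - z)) + c * z) * (\<Sum>k. bessel_term \<alpha> (\<mu> * \<nu>) z k))"
proof -
  let ?q = "\<mu> * \<nu>" and ?t = "- (\<mu> + \<nu>)"
  let ?h = "\<lambda>m. bisum m (gauss_coeff (m + \<alpha>) m) ?q ?t"
  let ?e = "\<lambda>l. (c * z) ^ l / fact l"
  have "corr_poly c (m + \<alpha>) m \<mu> \<nu> / (fact (m + \<alpha>) * fact m) * z ^ m
      = (\<Sum>l\<le>m. ?e l * (?h (m - l) * z ^ (m - l)))" for m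
  proof -
    have "corr_poly c (m + \<alpha>) m \<mu> \<nu> / (fact (m + \<alpha>) * fact m) * z ^ m
        = (\<Sum>l\<le>m. divpow c l * ?h (m - l) * z ^ m)"
      by (simp add: corr_poly_def symsum_def bisum_corr_coeff sum_distrib_right)
    also have "\<dots> = (\<Sum>l\<le>m. ?e l * (?h (m - l) * z ^ (m - l)))"
    proof (intro sum.cong refl)
      fix l assume "l \<in> {..m}"
      hence "z ^ m = z ^ l * z ^ (m - l)" by (simp add: power_add[symmetric])
      thus "divpow c l * ?h (m - l) * z ^ m = ?e l * (?h (m - l) * z ^ (m - l))"
        by (simp add: divpow_def power_mult_distrib)
    qed
    finally show ?thesis .
  qed
  moreover have "(\<lambda>m. \<Sum>l\<le>m. ?e l * (?h (m - l) * z ^ (m - l))) sums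
      ((\<Sum>l. ?e l) * (\<Sum>m. ?h m * z ^ m))"
  proof (rule Cauchy_product_sums)
    show "summable (\<lambda>l. norm (?e l))"
      using summable_norm_exp[of "c * z"] by (simp add: divide_inverse scaleR_conv_of_real mult.commute norm_mult)
  qed (rule gauss_bisum_sums(2)[OF z])
  moreover have "(\<Sum>l. ?e l) = exp (c * z)"
    using has_sum_imp_sums[OF exp_has_sum[of "c * z"]] by (simp add: sums_iff)
  moreover have "(\<Sum>m. ?h m * z ^ m) = (\<Sum>k. bessel_term \<alpha> ?q z k) * exp (?t * (z / (1 - z)))"
    by (rule sums_unique[symmetric, OF gauss_bisum_sums(1)[OF z]])
  ultimately show ?thesis by (simp add: exp_add mult_ac)
qed

lemma bessel_term_powi:
  fixes q z :: complex
  shows "bessel_term \<alpha> q z k = (q * z) ^ k / (fact (k + \<alpha>) * fact k) * (1 - z) powi (- 2 * int k - int \<alpha> - 3)"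
proof -
  have "- 2 * int k - int \<alpha> - 3 = - int (2 * k + \<alpha> + 3)" by simp
  thus ?thesis by (simp only: power_int_minus power_int_of_nat bessel_term_def divide_inverse)
qed

section \<open>Reduction to moments of order at most four\<close>

definition shifted_gram_det :: "nat \<Rightarrow> nat \<Rightarrow> (nat \<Rightarrow> nat \<Rightarrow> complex) \<Rightarrow> complex \<Rightarrow> complex" where
  "shifted_gram_det n m x \<mu> = Determinant.det (gram n m x - \<mu> \<cdot>\<^sub>m 1\<^sub>m m)"

lemma det_shift_sample_cov:
  assumes "A \<in> carrier_mat n m"
  shows "det_shift (sample_cov A) \<mu> = shifted_gram_det n m (\<lambda>i j. complex_of_real (A $$ (i, j))) \<mu>"
proof -
  have "map_mat complex_of_real (sample_cov A) = gram n m (\<lambda>i j. complex_of_real (A $$ (i, j)))"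
    using assms by (intro eq_matI) (auto simp: sample_cov_def gram_def scalar_prod_def atLeast0LessThan)
  moreover have "dim_row (sample_cov A) = m" using assms by (simp add: sample_cov_def)
  ultimately show ?thesis by (simp add: det_shift_def shifted_gram_det_def)
qed

lemma shifted_gram_det_char_poly:
  "shifted_gram_det n m x \<mu> = (- 1) ^ m * poly (char_poly (gram n m x)) \<mu>"
proof -
  let ?B = "gram n m x - \<mu> \<cdot>\<^sub>m 1\<^sub>m m"
  have "poly (char_poly (gram n m x)) \<mu> = Determinant.det ((- 1) \<cdot>\<^sub>m ?B)"
    unfolding char_poly_def
    by (rule poly_det_cong[of _ m]) (auto simp: char_poly_matrix_def gram_def)
  also have "\<dots> = (- 1) ^ m * Determinant.det ?B" by (simp add: gram_def)
  finally show ?thesis by (simp add: shifted_gram_det_def power_mult_distrib[symmetric])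
qed

text \<open>
  A matrix with determinant \<open>det (X\<^sup>T X - \<mu>)\<close> in which every entry of \<open>X\<close> occurs exactly twice, so that
  the Leibniz formula bounds the degree in each entry by 2.
\<close>

definition linearization :: "nat \<Rightarrow> nat \<Rightarrow> (nat \<Rightarrow> nat \<Rightarrow> complex) \<Rightarrow> complex \<Rightarrow> complex Matrix.mat" where
  "linearization n m x \<mu> = four_block_mat (1\<^sub>m n) (Matrix.mat n m (\<lambda>(i, j). x i j))
    (- Matrix.mat m n (\<lambda>(j, i). x i j)) (- \<mu> \<cdot>\<^sub>m 1\<^sub>m m)"

text \<open>A Schur complement: the unit triangular \<open>?L\<close> clears the lower left block
  and leaves the shifted Gram matrix.\<close>

lemma det_linearization: "Determinant.det (linearization n m x \<mu>) = shifted_gram_det n m x \<mu>"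
proof -
  let ?X = "Matrix.mat n m (\<lambda>(i, j). x i j)" and ?Y = "Matrix.mat m n (\<lambda>(j, i). x i j)"
  let ?L = "four_block_mat (1\<^sub>m n) (0\<^sub>m n m) ?Y (1\<^sub>m m)"
  have "?L * linearization n m x \<mu>
      = four_block_mat (1\<^sub>m n) ?X (0\<^sub>m m n) (gram n m x - \<mu> \<cdot>\<^sub>m 1\<^sub>m m)"
    unfolding linearization_def
    by (subst mult_four_block_mat[of _ n n _ m _ m _ _ n _ m])
       (auto intro!: cong_four_block_mat eq_matI simp: gram_def scalar_prod_def atLeast0LessThan
          if_distrib[of "\<lambda>c. _ * c"] cong: if_cong)
  moreover have "Determinant.det (?L * linearization n m x \<mu>)
      = Determinant.det ?L * Determinant.det (linearization n m x \<mu>)"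
    by (rule det_mult[of _ "n + m"]) (auto simp: linearization_def)
  moreover have "Determinant.det ?L = 1"
    by (subst det_four_block_mat_upper_right_zero[of _ n _ m]) auto
  moreover have "Determinant.det (four_block_mat (1\<^sub>m n) ?X (0\<^sub>m m n) (gram n m x - \<mu> \<cdot>\<^sub>m 1\<^sub>m m))
      = shifted_gram_det n m x \<mu>"
    unfolding shifted_gram_det_def
    by (subst det_four_block_mat_lower_left_zero[of _ n _ m]) (auto simp: gram_def)
  ultimately show ?thesis by simp
qed

text \<open>The exponent of \<open>x i j\<close> in the Leibniz term of \<open>p\<close>; the entry
  stands at positions \<open>(i, n + j)\<close> and \<open>(n + j, i)\<close>.\<close>

definition entry_degree :: "nat \<Rightarrow> (nat \<Rightarrow> nat) \<Rightarrow> nat \<Rightarrow> nat \<Rightarrow> nat" where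
  "entry_degree n p i j = of_bool (p i = n + j) + of_bool (p (n + j) = i)"

text \<open>The rest of the Leibniz term: the sign, the identity block, the minus signs of the lower
  left block and the diagonal entries \<open>- \<mu>\<close>.\<close>

definition leibniz_coeff :: "nat \<Rightarrow> nat \<Rightarrow> complex \<Rightarrow> (nat \<Rightarrow> nat) \<Rightarrow> complex" where
  "leibniz_coeff n m \<mu> p = signof p
    * (\<Prod>i<n. if p i < n then of_bool (p i = i) else 1)
    * (\<Prod>j<m. if p (n + j) < n then - 1 else if p (n + j) = n + j then - \<mu> else 0)"

lemma prod_power_of_bool:
  fixes f :: "nat \<Rightarrow> complex"
  assumes "i < n"
  shows "(\<Prod>j<n. f j ^ of_bool (i = j)) = f i"
proof -
  have "(\<Prod>j<n. f j ^ of_bool (i = j)) = (\<Prod>j<n. if i = j then f j else 1)"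
    by (intro prod.cong) auto
  thus ?thesis using assms by simp
qed

lemma shifted_gram_det_expansion:
  "shifted_gram_det n m x \<mu> = (\<Sum>p | p permutes {0..<n + m}.
    leibniz_coeff n m \<mu> p * (\<Prod>i<n. \<Prod>j<m. x i j ^ entry_degree n p i j))"
proof -
  let ?N = "linearization n m x \<mu>"
  have "(\<Prod>r = 0..<n + m. ?N $$ (r, p r)) =
      (\<Prod>i<n. if p i < n then of_bool (p i = i) else 1)
    * (\<Prod>j<m. if p (n + j) < n then - 1 else if p (n + j) = n + j then - \<mu> else 0)
    * (\<Prod>i<n. \<Prod>j<m. x i j ^ entry_degree n p i j)" (is "_ = ?C * ?D * ?E")
    if p: "p permutes {0..<n + m}" for p
  proof -
    have bound: "p r < n + m" if "r < n + m" for r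
      using permutes_in_image[OF p, of r] that by simp
    have "(\<Prod>r = 0..<n + m. ?N $$ (r, p r)) = (\<Prod>i<n. ?N $$ (i, p i)) * (\<Prod>j<m. ?N $$ (n + j, p (n + j)))"
      using prod.atLeastLessThan_concat[of 0 n "n + m" "\<lambda>r. ?N $$ (r, p r)"]
        prod.shift_bounds_nat_ivl[of "\<lambda>r. ?N $$ (r, p r)" 0 n m]
      by (simp add: atLeast0LessThan add.commute)
    also have "(\<Prod>i<n. ?N $$ (i, p i)) = ?C * (\<Prod>i<n. \<Prod>j<m. x i j ^ of_bool (p i = n + j))"
      unfolding prod.distrib[symmetric]
    proof (rule prod.cong[OF refl])
      fix i assume i: "i \<in> {..<n}"
      show "?N $$ (i, p i) = (if p i < n then of_bool (p i = i) else 1)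
          * (\<Prod>j<m. x i j ^ of_bool (p i = n + j))"
      proof (cases "p i < n")
        case True
        thus ?thesis using i by (auto simp: linearization_def intro!: prod.neutral)
      next
        case False
        then obtain s where s: "p i = n + s" using le_Suc_ex by (metis not_le)
        hence "s < m" using bound[of i] i by simp
        thus ?thesis using i s prod_power_of_bool[of s m "x i"] by (simp add: linearization_def)
      qed
    qed
    also have "(\<Prod>j<m. ?N $$ (n + j, p (n + j)))
        = ?D * (\<Prod>j<m. \<Prod>i<n. x i j ^ of_bool (p (n + j) = i))"
      unfolding prod.distrib[symmetric]
    proof (rule prod.cong[OF refl])
      fix j assume j: "j \<in> {..<m}"
      show "?N $$ (n + j, p (n + j)) = (if p (n + j) < n then - 1 else if p (n + j) = n + j then - \<mu> else 0)
          * (\<Prod>i<n. x i j ^ of_bool (p (n + j) = i))"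
      proof (cases "p (n + j) < n")
        case True
        thus ?thesis using j prod_power_of_bool[of "p (n + j)" n "\<lambda>i. x i j"]
          by (simp add: linearization_def)
      next
        case False
        hence "(\<Prod>i<n. x i j ^ of_bool (p (n + j) = i)) = 1" by (intro prod.neutral) auto
        thus ?thesis using j False bound[of "n + j"] by (auto simp: linearization_def)
      qed
    qed
    also have "(\<Prod>j<m. \<Prod>i<n. x i j ^ of_bool (p (n + j) = i))
        = (\<Prod>i<n. \<Prod>j<m. x i j ^ of_bool (p (n + j) = i))"
      by (rule prod.swap)
    finally show ?thesis
      by (simp add: entry_degree_def power_add prod.distrib mult_ac)
  qed
  moreover have "?N \<in> carrier_mat (n + m) (n + m)" by (auto simp: linearization_def)
  ultimately show ?thesis
    unfolding det_linearization[symmetric] leibniz_coeff_def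
    by (subst det_def'[of _ "n + m"]) (auto intro!: sum.cong simp: mult.assoc)
qed

lemma shifted_gram_det_mult_expansion:
  "shifted_gram_det n m x \<mu> * shifted_gram_det n m x \<nu> =
    (\<Sum>p | p permutes {0..<n + m}. \<Sum>p' | p' permutes {0..<n + m}.
      leibniz_coeff n m \<mu> p * leibniz_coeff n m \<nu> p'
      * (\<Prod>i<n. \<Prod>j<m. x i j ^ (entry_degree n p i j + entry_degree n p' i j)))"
  unfolding shifted_gram_det_expansion sum_product
  by (simp add: power_add prod.distrib mult_ac)

lemma entry_degree_le: "entry_degree n p i j \<le> 2"
  by (simp add: entry_degree_def)

context moment_functional
begin

lemma array_monomial:
  "array_mean n m (\<lambda>x. \<Prod>i<n. \<Prod>j<m. x i j ^ d i j) = (\<Prod>i<n. \<Prod>j<m. L (\<lambda>t. t ^ d i j))"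
  using iterate_functional_prod[OF linear_row[of m], of n "\<lambda>i r. \<Prod>j<m. r j ^ d i j"]
  by (simp only: row_monomial)

text \<open>Only moments of \<open>L\<close> of order at most four occur, which allows a
  term-by-term comparison with the true expectation.\<close>

lemma corr_expansion:
  "corr n m \<mu> \<nu> = (\<Sum>p | p permutes {0..<n + m}. \<Sum>p' | p' permutes {0..<n + m}.
      leibniz_coeff n m \<mu> p * leibniz_coeff n m \<nu> p'
      * (\<Prod>i<n. \<Prod>j<m. L (\<lambda>t. t ^ (entry_degree n p i j + entry_degree n p' i j))))"
proof -
  have signs: "(- 1) ^ m * a * ((- 1) ^ m * c) = a * c" for a c :: complex
    by (simp add: mult.assoc mult.left_commute[of a "(- 1) ^ m"])
  have "corr n m \<mu> \<nu> = array_mean n m (\<lambda>x. shifted_gram_det n m x \<mu> * shifted_gram_det n m x \<nu>)"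
    by (simp only: corr_def shifted_gram_det_char_poly signs)
  also have "\<dots> = (\<Sum>p | p permutes {0..<n + m}. \<Sum>p' | p' permutes {0..<n + m}.
      leibniz_coeff n m \<mu> p * leibniz_coeff n m \<nu> p'
      * (\<Prod>i<n. \<Prod>j<m. L (\<lambda>t. t ^ (entry_degree n p i j + entry_degree n p' i j))))"
    by (simp only: shifted_gram_det_mult_expansion functional_sum[OF linear_array]
        functional_cmult[OF linear_array] array_monomial)
  finally show ?thesis .
qed

end

text \<open>
  The weights at the nodes \<open>-2, \<dots>, 2\<close> are determined by the moments \<open>1, 0, 1, s, b\<close>; they may be
  negative.
\<close>

definition quadrature :: "complex \<Rightarrow> complex \<Rightarrow> (complex \<Rightarrow> complex) \<Rightarrow> complex" where
  "quadrature b s F = ((b - 1) / 24 - s / 12) * F (- 2) + ((4 - b) / 6 + s / 6) * F (- 1)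
    + (b - 1) / 4 * F 0 + ((4 - b) / 6 - s / 6) * F 1 + ((b - 1) / 24 + s / 12) * F 2"

lemma moment_functional_quadrature: "moment_functional (quadrature b s) b"
proof
  show "linear_functional (quadrature b s)"
    unfolding linear_functional_def quadrature_def
    by (intro conjI allI) (simp_all only: distrib_left mult.left_commute add_ac)
qed (simp_all add: quadrature_def field_simps)

text \<open>Single monomials of the expansion may contain cubes, so the third moment has to match as
  well.\<close>

lemma quadrature_cube: "quadrature b s (\<lambda>x. x ^ 3) = s"
  by (simp add: quadrature_def field_simps)

section \<open>Comparison with the probabilistic expectation\<close>

lemma iid_monomial_expectation:
  assumes M: "prob_space M" and X: "iid_random_matrix M Q n m X"
    and int: "\<And>i j. integrable Q (\<lambda>x. x ^ d i j)"
  shows "integrable M (\<lambda>\<omega>. \<Prod>i<n. \<Prod>j<m. complex_of_real (X \<omega> $$ (i, j)) ^ d i j)"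
    and "(LINT \<omega>|M. (\<Prod>i<n. \<Prod>j<m. complex_of_real (X \<omega> $$ (i, j)) ^ d i j))
      = (\<Prod>i<n. \<Prod>j<m. complex_of_real (LINT x|Q. x ^ d i j))"
proof -
  interpret prob_space M by (rule M)
  let ?I = "{..<n} \<times> {..<m}"
  define Y where "Y = (\<lambda>(i, j) \<omega>. (X \<omega> $$ (i, j)) ^ d i j)"
  have ind: "indep_vars (\<lambda>_. borel) (\<lambda>(i, j) \<omega>. X \<omega> $$ (i, j)) ?I"
    and distr: "\<And>i j. i < n \<Longrightarrow> j < m \<Longrightarrow> distr M borel (\<lambda>\<omega>. X \<omega> $$ (i, j)) = Q"
    using X by (auto simp: iid_random_matrix_def)
  have meas: "(\<lambda>\<omega>. X \<omega> $$ (i, j)) \<in> borel_measurable M" if "i < n" "j < m" for i j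
    using ind that by (auto simp: indep_vars_def)
  have "indep_vars (\<lambda>_. borel) (\<lambda>k \<omega>. (case k of (i, j) \<Rightarrow> \<lambda>x. x ^ d i j)
      ((case k of (i, j) \<Rightarrow> \<lambda>\<omega>. X \<omega> $$ (i, j)) \<omega>)) ?I"
    by (rule indep_vars_compose2[OF ind]) (auto split: prod.splits)
  also have "(\<lambda>k \<omega>. (case k of (i, j) \<Rightarrow> \<lambda>x. x ^ d i j)
      ((case k of (i, j) \<Rightarrow> \<lambda>\<omega>. X \<omega> $$ (i, j)) \<omega>)) = Y"
    by (auto simp: Y_def fun_eq_iff)
  finally have indY: "indep_vars (\<lambda>_. borel) Y ?I" .
  have intY: "integrable M (Y k)" and EY: "(LINT \<omega>|M. Y k \<omega>) = (case k of (i, j) \<Rightarrow> LINT x|Q. x ^ d i j)"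
    if k: "k \<in> ?I" for k
  proof -
    obtain i j where ij: "k = (i, j)" "i < n" "j < m" using k by auto
    have "integrable (distr M borel (\<lambda>\<omega>. X \<omega> $$ (i, j))) (\<lambda>x. x ^ d i j)"
      unfolding distr[OF ij(2,3)] by (rule int)
    thus "integrable M (Y k)"
      by (subst (asm) integrable_distr_eq) (use meas ij in \<open>auto simp: Y_def\<close>)
    have "(LINT x|Q. x ^ d i j) = (LINT x|distr M borel (\<lambda>\<omega>. X \<omega> $$ (i, j)). x ^ d i j)"
      by (simp only: distr[OF ij(2,3)])
    also have "\<dots> = (LINT \<omega>|M. (X \<omega> $$ (i, j)) ^ d i j)"
      by (rule integral_distr) (use meas ij in auto)
    finally show "(LINT \<omega>|M. Y k \<omega>) = (case k of (i, j) \<Rightarrow> LINT x|Q. x ^ d i j)"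
      by (simp add: Y_def ij)
  qed
  have prod: "(\<Prod>i<n. \<Prod>j<m. complex_of_real (X \<omega> $$ (i, j)) ^ d i j) = complex_of_real (\<Prod>k\<in>?I. Y k \<omega>)" for \<omega>
    by (simp add: prod.cartesian_product Y_def case_prod_unfold)
  have fin: "finite ?I" by simp
  show "integrable M (\<lambda>\<omega>. \<Prod>i<n. \<Prod>j<m. complex_of_real (X \<omega> $$ (i, j)) ^ d i j)"
    unfolding prod by (rule integrable_of_real, rule indep_vars_integrable[OF fin indY intY])
  have "(LINT \<omega>|M. (\<Prod>k\<in>?I. Y k \<omega>)) = (\<Prod>k\<in>?I. LINT \<omega>|M. Y k \<omega>)"
    by (rule indep_vars_lebesgue_integral[OF fin indY intY])
  also have "\<dots> = (\<Prod>(i, j)\<in>?I. LINT x|Q. x ^ d i j)"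
    by (intro prod.cong refl) (simp add: EY)
  finally show "(LINT \<omega>|M. (\<Prod>i<n. \<Prod>j<m. complex_of_real (X \<omega> $$ (i, j)) ^ d i j))
      = (\<Prod>i<n. \<Prod>j<m. complex_of_real (LINT x|Q. x ^ d i j))"
    unfolding prod integral_complex_of_real by (simp add: prod.cartesian_product case_prod_unfold)
qed

text \<open>Both sides have the same finite Leibniz expansion. Independence factorises the mean of
  each monomial, and the moments agree up to order four.\<close>

lemma corr2_eq_corr:
  assumes M: "prob_space M" and X: "iid_random_matrix M Q n m X"
    and int: "\<And>d. d \<le> 4 \<Longrightarrow> integrable Q (\<lambda>x. x ^ d)"
    and L: "moment_functional L b"
    and moments: "\<And>d. d \<le> 4 \<Longrightarrow> L (\<lambda>x. x ^ d) = complex_of_real (LINT x|Q. x ^ d)"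
  shows "corr2 M X \<mu> \<nu> = moment_functional.corr L n m \<mu> \<nu>"
proof -
  interpret moment_functional L b by (rule L)
  let ?P = "{p. p permutes {0..<n + m}}"
  let ?e = "\<lambda>p p' i j. entry_degree n p i j + entry_degree n p' i j"
  let ?c = "\<lambda>p p'. leibniz_coeff n m \<mu> p * leibniz_coeff n m \<nu> p'"
  let ?x = "\<lambda>\<omega> i j. complex_of_real (X \<omega> $$ (i, j))"
  have e: "?e p p' i j \<le> 4" for p p' i j
    using entry_degree_le[of n p i j] entry_degree_le[of n p' i j] by simp
  note mono = iid_monomial_expectation[OF M X int[OF e]]
  have "corr2 M X \<mu> \<nu> = (LINT \<omega>|M. (\<Sum>p\<in>?P. \<Sum>p'\<in>?P. ?c p p' * (\<Prod>i<n. \<Prod>j<m. ?x \<omega> i j ^ ?e p p' i j)))"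
    unfolding corr2_def
  proof (rule Bochner_Integration.integral_cong[OF refl])
    fix \<omega> assume "\<omega> \<in> space M"
    hence "X \<omega> \<in> carrier_mat n m" using X by (simp add: iid_random_matrix_def)
    thus "det_shift (sample_cov (X \<omega>)) \<mu> * det_shift (sample_cov (X \<omega>)) \<nu>
        = (\<Sum>p\<in>?P. \<Sum>p'\<in>?P. ?c p p' * (\<Prod>i<n. \<Prod>j<m. ?x \<omega> i j ^ ?e p p' i j))"
      by (simp only: det_shift_sample_cov shifted_gram_det_mult_expansion)
  qed
  also have "\<dots> = (\<Sum>p\<in>?P. \<Sum>p'\<in>?P. ?c p p' * (LINT \<omega>|M. (\<Prod>i<n. \<Prod>j<m. ?x \<omega> i j ^ ?e p p' i j)))"
    by (simp add: mono(1))
  also have "\<dots> = corr n m \<mu> \<nu>"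
    unfolding corr_expansion mono(2) moments[OF e] ..
  finally show ?thesis .
qed

lemma (in prob_space) integrable_power_le_4:
  fixes Y :: "'a \<Rightarrow> real"
  assumes Y: "random_variable borel Y" and int: "integrable M (\<lambda>\<omega>. Y \<omega> ^ 4)" and d: "d \<le> 4"
  shows "integrable M (\<lambda>\<omega>. Y \<omega> ^ d)"
proof (rule Bochner_Integration.integrable_bound)
  show "integrable M (\<lambda>\<omega>. 1 + Y \<omega> ^ 4)" using int by simp
  show "(\<lambda>\<omega>. Y \<omega> ^ d) \<in> borel_measurable M" using Y by simp
  have "\<bar>y\<bar> ^ d \<le> 1 + y ^ 4" for y :: real
  proof (cases "\<bar>y\<bar> \<le> 1")
    case True
    hence "\<bar>y\<bar> ^ d \<le> 1" by (simp add: power_le_one)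
    moreover have "0 \<le> y ^ 4" by simp
    ultimately show ?thesis by linarith
  next
    case False
    hence "\<bar>y\<bar> ^ d \<le> \<bar>y\<bar> ^ 4" using d by (intro power_increasing) auto
    thus ?thesis by simp
  qed
  thus "AE \<omega> in M. norm (Y \<omega> ^ d) \<le> norm (1 + Y \<omega> ^ 4)"
    by (intro AE_I2) (simp add: power_abs)
qed

theorem proposition2p3:
  fixes Q :: "real measure" and M :: "'a measure"
    and X :: "nat \<Rightarrow> nat \<Rightarrow> 'a \<Rightarrow> real Matrix.mat"
    and b bstar :: real and \<alpha> :: nat and \<mu> \<nu> z :: complex
  assumes Q: "real_distribution Q"
    and mean: "(LINT x|Q. x) = 0"
    and var: "prob_space.variance Q (\<lambda>x. x) = 1"
    and fourth_moment: "integrable Q (\<lambda>x. x ^ 4)"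
    and b: "b = (LINT x|Q. x ^ 4)"
    and bstar: "bstar = b - 3"
    and M: "prob_space M"
    and X: "\<And>n m. m \<le> n \<Longrightarrow> iid_random_matrix M Q n m (X n m)"
    and z: "norm z < 1"
  shows "summable (\<lambda>k. (\<mu> * \<nu> * z) ^ k / (fact (k + \<alpha>) * fact k)
                        * (1 - z) powi (- 2 * int k - int \<alpha> - 3))
    \<and> (\<lambda>m. corr2 M (X (m + \<alpha>) m) \<mu> \<nu> / (fact (m + \<alpha>) * fact m) * z ^ m)
      sums (exp (- (\<mu> + \<nu>) * (z / (1 - z)) + complex_of_real bstar * z)
            * (\<Sum>k. (\<mu> * \<nu> * z) ^ k / (fact (k + \<alpha>) * fact k)
                    * (1 - z) powi (- 2 * int k - int \<alpha> - 3)))"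
proof -
  interpret Q: real_distribution Q by (rule Q)
  \<comment> \<open>This functional shares all moments of order at most four with
    \<open>Q\<close>.\<close>
  define L where "L = quadrature (complex_of_real b) (complex_of_real (LINT x|Q. x ^ 3))"
  interpret moment_functional L "complex_of_real b"
    unfolding L_def by (rule moment_functional_quadrature)
  have int: "integrable Q (\<lambda>x. x ^ d)" if "d \<le> 4" for d
    using Q.integrable_power_le_4[of "\<lambda>x. x"] fourth_moment that by simp
  have "L (\<lambda>x. x ^ d) = complex_of_real (LINT x|Q. x ^ d)" if "d \<le> 4" for d
  proof -
    have var': "(LINT x|Q. x ^ 2) = 1" using var by (simp add: mean)
    consider "d = 0" | "d = 1" | "d = 2" | "d = 3" | "d = 4" using \<open>d \<le> 4\<close> by linarith
    thus ?thesis
    proof cases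
      case 4
      thus ?thesis by (simp only: L_def quadrature_cube)
    qed (simp_all add: moment_0 moment_1 moment_2 moment_4 mean var' b Q.prob_space[unfolded Q.space_eq_univ])
  qed
  hence "corr2 M (X (m + \<alpha>) m) \<mu> \<nu> = corr_poly (complex_of_real bstar) (m + \<alpha>) m \<mu> \<nu>" for m
    using corr2_eq_corr[OF M X int moment_functional_axioms, of m "m + \<alpha>" \<mu> \<nu>]
    by (simp add: corr_eq bstar)
  moreover have "summable (bessel_term \<alpha> (\<mu> * \<nu>) z)"
    using summable_norm_bessel_term[OF z] by (rule summable_norm_cancel)
  ultimately show ?thesis
    using corr_poly_sums[OF z, of "complex_of_real bstar" \<alpha> \<mu> \<nu>]
    by (simp only: bessel_term_powi[abs_def] simp_thms)
qed

end
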